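(* Let $n\ge 3$ be an integer, let $D=D_2\cup D_3$ be a dominating set in $G_{3,2}$ with $|D|=\binom{n}{2}-\left\lfloor\frac{(n+1)^2}{8}\right\rfloor$, where $D_i=D\cap\binom{[n]}{i}$ for $i\in\{2,3\}$, and let $H=H(D)$ be the corresponding graph. 1. If $n\equiv 0\pmod 4$, then $H$ is isomorphic to $K^+_{n/2,\,n/2}$. 2. If $n\equiv 1\pmod 4$, then $H$ is isomorphic to one of the following graphs: $H_{5a}$, $H_{5b}$, $H_9$, or $K^+_{s,n-s}$ for some $s$ with $2s\in\{n-1,n+1,n+3\}$. 3. If $n\equiv 2\pmod 4$, then $H$ is isomorphic to $K^+_{(n+2)/2,\,(n-2)/2}$. 4. If $n\equiv 3\pmod 4$, then $H$ is isomorphic to $K^+_{(n+1)/2,\,(n-1)/2}$.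
   Context: All graphs are simple. For a positive integer $n$, $[n]=\{1,\dots,n\}$ and $\binom{[n]}{k}$ is the set of $k$-element subsets of $[n]$. $G_{3,2}$ is the bipartite graph with vertex set $\binom{[n]}{2}\cup\binom{[n]}{3}$ in which $A\in\binom{[n]}{2}$ and $B\in\binom{[n]}{3}$ are adjacent if and only if $A\subseteq B$. A vertex set $D$ of a graph is dominating if every vertex not in $D$ has a neighbor in $D$. The graph $H(D)$ associated with a dominating set $D=D_2\cup D_3$ of $G_{3,2}$ has vertex set $[n]$, and two distinct vertices $x,y$ are adjacent in $H(D)$ if and only if $\{x,y\}\notin D$ but $\{x,y,z\}\in D$ for some $z\in[n]\setminus\{x,y\}$. Equivalently, $E(H(D))=\Delta D_3\setminus D_2$, where $\Delta D_3=\{A: |A|=2 \text{ and } A\subseteq X\text{ for some }X\in D_3\}$. For $1<s<n$, $K^+_{s,n-s}$ is the graph with vertex set $[n]$ such that: the set $\{1,\dots,s\}$ induces a matching of size $\lfloor s/2\rfloor$ (plus one additional isolated vertex if $s$ is odd); the set $\{s+1,\dots,n\}$ is independent; and every vertex $u\in\{1,\dots,s\}$ is adjacent to every vertex $v\in\{s+1,\dots,n\}$. $H_{5a}$ is the graph with vertices $v_1,\dots,v_5$ and edges $v_1v_2, v_2v_3, v_3v_5, v_5v_4, v_4v_1, v_4v_2, v_2v_5$. $H_{5b}$ is the graph with vertices $v_1,\dots,v_5$ and edges $v_1v_2, v_2v_3, v_3v_4, v_4v_1, v_1v_5, v_2v_5, v_3v_5, v_4v_5$. $H_9$ is the graph with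 vertices $v_1,\dots,v_9$ and edges $v_1v_2, v_2v_3, v_3v_4, v_4v_6, v_6v_3, v_3v_7, v_7v_2, v_2v_5, v_5v_1, v_1v_9, v_9v_8, v_8v_7, v_7v_9, v_9v_6, v_6v_1, v_4v_5, v_5v_8, v_8v_4$. (Since $H$ has $n$ vertices, $H_{5a}$ and $H_{5b}$ can occur only for $n=5$, and $H_9$ only for $n=9$.) *)

theory Defs
  imports Complex_Main
begin

record 'a ugraph =
  verts :: "'a set"
  edges :: "'a set set"

definition simple_graph :: "'a ugraph \<Rightarrow> bool" where
  "simple_graph G \<longleftrightarrow> (\<forall>e\<in>edges G. e \<subseteq> verts G \<and> card e = 2)"

definition adjacent :: "'a ugraph \<Rightarrow> 'a \<Rightarrow> 'a \<Rightarrow> bool" where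
  "adjacent G x y \<longleftrightarrow> {x, y} \<in> edges G"

definition isomorphic :: "'a ugraph \<Rightarrow> 'b ugraph \<Rightarrow> bool" where
  "isomorphic G G' \<longleftrightarrow>
     (\<exists>f. bij_betw f (verts G) (verts G') \<and>
          (\<forall>x\<in>verts G. \<forall>y\<in>verts G. adjacent G x y \<longleftrightarrow> adjacent G' (f x) (f y)))"

definition dominating :: "'a ugraph \<Rightarrow> 'a set \<Rightarrow> bool" where
  "dominating G D \<longleftrightarrow>
     D \<subseteq> verts G \<and> (\<forall>v\<in>verts G - D. \<exists>u\<in>D. adjacent G v u)"

definition ksubsets :: "nat \<Rightarrow> nat \<Rightarrow> nat set set" where
  "ksubsets n k = {A. A \<subseteq> {1..n} \<and> card A = k}"

definition G32 :: "nat \<Rightarrow> nat set ugraph" where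
  "G32 n = \<lparr>verts = ksubsets n 2 \<union> ksubsets n 3,
            edges = {{A, B} | A B. A \<in> ksubsets n 2 \<and> B \<in> ksubsets n 3 \<and> A \<subseteq> B}\<rparr>"

definition H_of :: "nat \<Rightarrow> nat set set \<Rightarrow> nat ugraph" where
  "H_of n D = \<lparr>verts = {1..n},
               edges = {{x, y} | x y. x \<in> {1..n} \<and> y \<in> {1..n} \<and> x \<noteq> y \<and>
                                      {x, y} \<notin> D \<and> (\<exists>z\<in>{1..n} - {x, y}. {x, y, z} \<in> D)}\<rparr>"

text \<open>The graph \<open>Kplus s t\<close> is \<open>K\<^sup>+\<^sub>s\<^sub>,\<^sub>t\<close> on \<open>s + t\<close> vertices.  The maximum matching on
  \<open>{1..s}\<close> is fixed as \<open>{1,2}, {3,4}, \<dots>\<close>, so that \<open>s\<close> is the isolated vertex for odd \<open>s\<close>.\<close>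

definition Kplus :: "nat \<Rightarrow> nat \<Rightarrow> nat ugraph" where
  "Kplus s t = \<lparr>verts = {1..s + t},
                edges = {{2 * i - 1, 2 * i} | i. 1 \<le> i \<and> i \<le> s div 2} \<union>
                        {{u, v} | u v. u \<in> {1..s} \<and> v \<in> {s + 1..s + t}}\<rparr>"

definition H5a :: "nat ugraph" where
  "H5a = \<lparr>verts = {1..5}, edges = {{1,2}, {2,3}, {3,5}, {5,4}, {4,1}, {4,2}, {2,5}}\<rparr>"

definition H5b :: "nat ugraph" where
  "H5b = \<lparr>verts = {1..5}, edges = {{1,2}, {2,3}, {3,4}, {4,1}, {1,5}, {2,5}, {3,5}, {4,5}}\<rparr>"

definition H9 :: "nat ugraph" where
  "H9 = \<lparr>verts = {1..9},
         edges = {{1,2}, {2,3}, {3,4}, {4,6}, {6,3}, {3,7}, {7,2}, {2,5}, {5,1},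
                  {1,9}, {9,8}, {8,7}, {7,9}, {9,6}, {6,1}, {4,5}, {5,8}, {8,4}}\<rparr>"

lemma simple_graph_G32: "simple_graph (G32 n)"
proof -
  have "A \<noteq> B" if "A \<in> ksubsets n 2" "B \<in> ksubsets n 3" for A B
    using that by (auto simp: ksubsets_def)
  then show ?thesis
    by (auto simp: simple_graph_def G32_def)
qed

lemma simple_graph_H_of: "simple_graph (H_of n D)"
  by (auto simp: simple_graph_def H_of_def)

lemma simple_graph_Kplus: "simple_graph (Kplus s t)"
proof -
  have "card {2 * i - 1, 2 * i} = 2" if "1 \<le> i" for i :: nat
    using that by (subst card_2_iff) (rule exI[of _ "2 * i - 1"], rule exI[of _ "2 * i"], auto)
  then show ?thesis
    by (auto simp: simple_graph_def Kplus_def)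
qed

lemma simple_graph_H5a_H5b_H9: "simple_graph H5a" "simple_graph H5b" "simple_graph H9"
  by (auto simp: simple_graph_def H5a_def H5b_def H9_def)

lemma edges_H_of:
  assumes "D \<subseteq> verts (G32 n)"
  shows "edges (H_of n D) = {A. card A = 2 \<and> (\<exists>X \<in> D \<inter> ksubsets n 3. A \<subseteq> X)} - D \<inter> ksubsets n 2"
    (is "?L = ?R")
proof (intro subset_antisym subsetI)
  fix e assume "e \<in> ?L"
  then have "\<exists>x y. e = {x, y} \<and> x \<in> {1..n} \<and> y \<in> {1..n} \<and> x \<noteq> y \<and>
                  {x, y} \<notin> D \<and> (\<exists>z\<in>{1..n} - {x, y}. {x, y, z} \<in> D)"
    unfolding H_of_def by simp
  then obtain x y z where *: "e = {x, y}" "x \<in> {1..n}" "y \<in> {1..n}" "x \<noteq> y" "{x, y} \<notin> D"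
    "z \<in> {1..n} - {x, y}" "{x, y, z} \<in> D"
    by (elim exE conjE bexE)
  from * have "{x, y, z} \<in> D \<inter> ksubsets n 3"
    by (simp add: ksubsets_def)
  moreover have "e \<subseteq> {x, y, z}" "card e = 2" "e \<notin> D"
    using * by simp_all
  ultimately show "e \<in> ?R" by blast
next
  fix e assume e: "e \<in> ?R"
  then obtain X where X: "X \<in> D" "X \<in> ksubsets n 3" "e \<subseteq> X" by blast
  have "card e = 2" using e by simp
  then obtain x y where xy: "e = {x, y}" "x \<noteq> y" unfolding card_2_iff by blast
  have Xn: "X \<subseteq> {1..n}" and "card X = 3"
    using X(2) by (simp_all add: ksubsets_def)
  then have "card (X - e) = 1"
    using X(3) xy \<open>card e = 2\<close> by (subst card_Diff_subset) simp_all
  then obtain z where z: "X - e = {z}" unfolding One_nat_def card_1_singleton_iff by blast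
  then have "X = insert z e" "z \<notin> e" using X(3) by blast+
  then have XX: "X = {x, y, z}" and "z \<notin> {x, y}" using xy by blast+
  then have xyz: "x \<in> {1..n}" "y \<in> {1..n}" "z \<in> {1..n} - {x, y}"
    using Xn by simp_all
  have "e \<in> ksubsets n 2"
    using X(3) Xn \<open>card e = 2\<close> by (simp add: ksubsets_def)
  then have "{x, y} \<notin> D"
    using e xy by simp
  moreover have "\<exists>z\<in>{1..n} - {x, y}. {x, y, z} \<in> D"
    using xyz(3) X(1) unfolding XX by (rule rev_bexI)
  ultimately have "\<exists>x y. e = {x, y} \<and> x \<in> {1..n} \<and> y \<in> {1..n} \<and> x \<noteq> y \<and>
                        {x, y} \<notin> D \<and> (\<exists>z\<in>{1..n} - {x, y}. {x, y, z} \<in> D)"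
    using xy xyz(1,2) by (intro exI[of _ x] exI[of _ y] conjI)
  then show "e \<in> ?L"
    unfolding H_of_def by simp
qed

end

theory Submission
  imports Defs
begin

text \<open>Write \<open>T\<close> for the triples in \<open>D\<close>.  Domination says that the edges of \<open>H\<close> are exactly the pairs
  outside \<open>D\<close>, that \<open>T\<close> contains all triangles of \<open>H\<close>, and that \<open>T\<close> covers every edge; hence
  \<open>|E| - |T| = \<lfloor>(n + 1)\<^sup>2 / 8\<rfloor>\<close>.  Fix a vertex \<open>w\<close> and count walks \<open>w, x, y\<close> with \<open>y \<noteq> w\<close>.  If \<open>y\<close> is
  adjacent to \<open>w\<close>, charge the walk to the triangle \<open>wxy\<close>, otherwise to any triple containing \<open>xy\<close>.  No
  triple is charged more than twice, so \<open>slack w = 2|T| - (\<Sum>x \<sim> w. d x - 1)\<close> is nonnegative.  Summing over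
  \<open>w\<close> gives
  \<open>(\<Sum>w. (2 d w - (n + 1))\<^sup>2 + 4 slack w) = n ((n + 1)\<^sup>2 mod 8)\<close>,
  so nearly all degrees are close to \<open>(n + 1) / 2\<close> and nearly all slacks are small.  A vertex without slack
  sees every triangle that avoids it as split 1:2 between its neighbours and the rest, and an edge between
  the two sides lies in only one triple.  If no vertex has slack, then either an edge with two common
  neighbours forces the join structure of \<open>K\<^sup>+\<close>, or every edge lies in one triangle and counting
  degrees leaves only a triangle or \<open>H\<^sub>9\<close>.  For \<open>n \<equiv> 1 (mod 4)\<close> slack can be positive; with
  \<open>g v = d v - (n + 1) / 2\<close> it is determined by the degrees of the nonneighbours,
  \<open>slack p = 1 + (\<Sum>x \<not>\<sim> p. g x) - g p ((n - 1) / 2)\<close>, and the case split is on the sign of \<open>g\<close>.\<close>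

section \<open>Slack of a vertex in a triple cover\<close>

text \<open>\<open>TT\<close> stands for the triples in the dominating set, and the pairs in it are
  encoded as the nonedges of \<open>H\<close>. Domination of triples becomes
  \<open>triangle\<close>, domination of pairs becomes \<open>covered\<close>.\<close>

locale triple_cover =
  fixes H :: "'a ugraph" and TT :: "'a set set"
  assumes simple: "simple_graph H"
    and finite_verts: "finite (verts H)"
    and triple: "T \<in> TT \<Longrightarrow> T \<subseteq> verts H \<and> card T = 3"
    and triangle: "adjacent H x y \<Longrightarrow> adjacent H y z \<Longrightarrow> adjacent H x z \<Longrightarrow> {x, y, z} \<in> TT"
    and covered: "adjacent H x y \<Longrightarrow> \<exists>z. z \<noteq> x \<and> z \<noteq> y \<and> {x, y, z} \<in> TT"
begin

abbreviation V :: "'a set" where "V \<equiv> verts H"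
abbreviation adj :: "'a \<Rightarrow> 'a \<Rightarrow> bool" where "adj \<equiv> adjacent H"

definition N :: "'a \<Rightarrow> 'a set" where "N v = {u. adj v u}"
definition d :: "'a \<Rightarrow> int" where "d v = int (card (N v))"
definition slack :: "'a \<Rightarrow> int" where
  "slack w = 2 * int (card TT) - (\<Sum>x\<in>N w. d x - 1)"

lemma adj_sym: "adj x y \<longleftrightarrow> adj y x"
  by (simp add: adjacent_def insert_commute)

lemma adj_verts: "adj x y \<Longrightarrow> x \<in> V \<and> y \<in> V"
  using simple by (auto simp: simple_graph_def adjacent_def)

lemma not_adj_self [simp]: "\<not> adj x x"
  using simple by (auto simp: simple_graph_def adjacent_def)

lemma adj_neq: "adj x y \<Longrightarrow> x \<noteq> y"
  by auto

lemma N_iff [simp]: "u \<in> N v \<longleftrightarrow> adj v u"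
  by (simp add: N_def)

lemma N_subset: "N v \<subseteq> V"
  using adj_verts by auto

lemma finite_N [simp]: "finite (N v)"
  using N_subset finite_verts finite_subset by blast

lemma finite_TT: "finite TT"
  using triple by (intro finite_subset[OF _ finite_Pow_iff[THEN iffD2, OF finite_verts]]) auto

section \<open>Charging walks of length two to triples\<close>

definition walks :: "'a \<Rightarrow> ('a \<times> 'a) set" where
  "walks w = {(x, y). adj w x \<and> adj x y \<and> y \<noteq> w}"

text \<open>A walk whose end is not adjacent to \<open>w\<close> is charged to every triple
  containing its last edge, not to a chosen one. Slack zero then yields uniqueness of that triple as
  well.\<close>

definition charged :: "'a \<Rightarrow> 'a \<times> 'a \<Rightarrow> 'a set \<Rightarrow> bool" where
  "charged w e T \<longleftrightarrow>
     fst e \<in> T \<and> snd e \<in> T \<and> (adj w (snd e) \<longrightarrow> T = {w, fst e, snd e})"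

lemma walks_Sigma: "walks w = (SIGMA x:N w. N x - {w})"
  by (auto simp: walks_def)

lemma finite_walks: "finite (walks w)"
  by (simp add: walks_Sigma)

lemma card_walks: "int (card (walks w)) = (\<Sum>x\<in>N w. d x - 1)"
proof -
  have "int (card (walks w)) = (\<Sum>x\<in>N w. int (card (N x - {w})))"
    by (simp add: walks_Sigma card_SigmaI)
  also have "\<dots> = (\<Sum>x\<in>N w. d x - 1)"
  proof (rule sum.cong)
    fix x assume "x \<in> N w"
    then have "w \<in> N x" by (simp add: adj_sym)
    then have "card (N x) = Suc (card (N x - {w}))"
      using card_Suc_Diff1[OF finite_N] by metis
    then show "int (card (N x - {w})) = d x - 1"
      by (simp add: d_def)
  qed simp
  finally show ?thesis .
qed

lemma card_3_obtain:
  assumes "card T = 3" obtains a b c where "T = {a, b, c}" "a \<noteq> b" "a \<noteq> c" "b \<noteq> c"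
  using assms by (auto simp: card_3_iff)

lemma charged_inside:
  assumes "T = {w, x, y}" "w \<noteq> x" "w \<noteq> y" "x \<noteq> y"
  shows "{e \<in> walks w. charged w e T} \<subseteq> {(x, y), (y, x)}"
proof
  fix e assume e: "e \<in> {e \<in> walks w. charged w e T}"
  obtain u v where uv: "e = (u, v)" by fastforce
  have "u \<in> T \<and> v \<in> T \<and> adj w u \<and> adj u v \<and> v \<noteq> w"
    using e unfolding uv walks_def charged_def by simp
  then have *: "u \<in> {w, x, y}" "v \<in> {w, x, y}" "adj w u" "adj u v" "v \<noteq> w"
    using assms(1) by blast+
  then have "u \<noteq> v" "u \<noteq> w" "v \<noteq> w" by auto
  with *(1,2) show "e \<in> {(x, y), (y, x)}"
    unfolding uv by simp blast
qed

lemma charged_outside: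
  assumes "w \<notin> T"
  shows "{e \<in> walks w. charged w e T} =
    {(x, y). x \<in> T \<and> y \<in> T \<and> adj w x \<and> \<not> adj w y \<and> adj x y}"
  using assms by (auto simp: walks_def charged_def)

text \<open>If \<open>w\<close> lies in \<open>T\<close>, only the two orders of the other two
  vertices can be charged. Otherwise a charged walk leads from a neighbour of \<open>w\<close> in
  \<open>T\<close> to a nonneighbour in \<open>T\<close>, and a split of three vertices into i and 3
  - i leaves at most i (3 - i), hence at most 2, such pairs.\<close>

lemma card_charged_triple:
  assumes "T \<in> TT"
  shows "card {e \<in> walks w. charged w e T} \<le> 2"
proof (cases "w \<in> T")
  case True
  have "card (T - {w}) = 2" using triple[OF assms] True by simp
  then obtain x y where xy: "T - {w} = {x, y}" "x \<noteq> y" unfolding card_2_iff by blast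
  then have T: "T = {w, x, y}" "w \<noteq> x" "w \<noteq> y" "x \<noteq> y"
    using True by blast+
  then have "card {e \<in> walks w. charged w e T} \<le> card {(x, y), (y, x)}"
    by (intro card_mono charged_inside) auto
  then show ?thesis using T by simp
next
  case False
  have "card T = 3" using triple[OF assms] by simp
  then obtain a b c where T: "T = {a, b, c}" "a \<noteq> b" "a \<noteq> c" "b \<noteq> c"
    by (rule card_3_obtain)
  have "card {(x, y). x \<in> T \<and> y \<in> T \<and> adj w x \<and> \<not> adj w y \<and> adj x y} \<le>
      card ({x\<in>T. adj w x} \<times> {y\<in>T. \<not> adj w y})"
    using T(1) by (intro card_mono) auto
  also have "\<dots> \<le> 2"
  proof -
    have "{x\<in>T. adj w x} = (if adj w a then {a} else {}) \<union> (if adj w b then {b} else {}) \<union>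
        (if adj w c then {c} else {})"
      "{x\<in>T. \<not> adj w x} = (if adj w a then {} else {a}) \<union> (if adj w b then {} else {b}) \<union>
        (if adj w c then {} else {c})"
      using T(1) by auto
    then show ?thesis
      using T(2-) by (simp add: card_cartesian_product)
  qed
  finally show ?thesis
    using False by (simp add: charged_outside)
qed

lemma card_charged_walk:
  assumes "e \<in> walks w"
  shows "card {T \<in> TT. charged w e T} \<ge> 1"
proof -
  obtain x y where e: "e = (x, y)" "adj w x" "adj x y" "y \<noteq> w"
    using assms by (auto simp: walks_def)
  have "\<exists>T\<in>TT. charged w e T"
  proof (cases "adj w y")
    case True
    then show ?thesis
      using triangle[of w x y] e by (intro bexI[of _ "{w, x, y}"]) (auto simp: charged_def)
  next
    case False
    then show ?thesis
      using covered[OF e(3)] e by (auto simp: charged_def)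
  qed
  then have "{T \<in> TT. charged w e T} \<noteq> {}" by blast
  then have "card {T \<in> TT. charged w e T} > 0"
    using finite_TT by (simp add: card_gt_0_iff)
  then show ?thesis by simp
qed

lemma int_card_filter:
  "finite A \<Longrightarrow> int (card {x \<in> A. P x}) = (\<Sum>x\<in>A. of_bool (P x))"
  by (simp add: of_bool_def sum.If_cases Collect_conj_eq)

text \<open>Counting the charged incidences by triples and by walks gives the same number. The slack
  thus splits into the capacity left over in the triples and the surplus charges of the walks; both
  sums are nonnegative term by term.\<close>

lemma slack_eq:
  "slack w = (\<Sum>T\<in>TT. 2 - int (card {e \<in> walks w. charged w e T})) +
     (\<Sum>e\<in>walks w. int (card {T \<in> TT. charged w e T}) - 1)"
proof -
  have "(\<Sum>T\<in>TT. int (card {e \<in> walks w. charged w e T})) =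
      (\<Sum>T\<in>TT. \<Sum>e\<in>walks w. of_bool (charged w e T))"
    by (simp add: int_card_filter[OF finite_walks])
  also have "\<dots> = (\<Sum>e\<in>walks w. \<Sum>T\<in>TT. of_bool (charged w e T))"
    by (rule sum.swap)
  also have "\<dots> = (\<Sum>e\<in>walks w. int (card {T \<in> TT. charged w e T}))"
    by (simp add: int_card_filter[OF finite_TT])
  finally show ?thesis
    unfolding slack_def card_walks[symmetric] by (simp add: sum_subtractf)
qed

lemma slack_nonneg: "slack w \<ge> 0"
  unfolding slack_eq
proof (intro add_nonneg_nonneg sum_nonneg)
  fix T assume "T \<in> TT"
  then show "2 - int (card {e \<in> walks w. charged w e T}) \<ge> 0"
    using card_charged_triple[of T w] by linarith
next
  fix e assume "e \<in> walks w"
  then show "int (card {T \<in> TT. charged w e T}) - 1 \<ge> 0"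
    using card_charged_walk[of e w] by linarith
qed

section \<open>Structure forced at a vertex of slack zero\<close>

lemma slack_0D:
  assumes "slack w = 0"
  shows "T \<in> TT \<Longrightarrow> card {e \<in> walks w. charged w e T} = 2"
    and "e \<in> walks w \<Longrightarrow> card {T \<in> TT. charged w e T} = 1"
proof -
  have a: "2 - int (card {e \<in> walks w. charged w e T}) \<ge> 0" if "T \<in> TT" for T
    using card_charged_triple[OF that, of w] by linarith
  have b: "int (card {T \<in> TT. charged w e T}) - 1 \<ge> 0" if "e \<in> walks w" for e
    using card_charged_walk[OF that] by linarith
  have "(\<Sum>T\<in>TT. 2 - int (card {e \<in> walks w. charged w e T})) \<ge> 0"
    "(\<Sum>e\<in>walks w. int (card {T \<in> TT. charged w e T}) - 1) \<ge> 0"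
    using a b by (simp_all add: sum_nonneg)
  with assms have "(\<Sum>T\<in>TT. 2 - int (card {e \<in> walks w. charged w e T})) = 0"
     "(\<Sum>e\<in>walks w. int (card {T \<in> TT. charged w e T}) - 1) = 0"
    unfolding slack_eq by (simp_all only: add_nonneg_eq_0_iff)
  then have "\<forall>T\<in>TT. 2 - int (card {e \<in> walks w. charged w e T}) = 0"
    "\<forall>e\<in>walks w. int (card {T \<in> TT. charged w e T}) - 1 = 0"
    using a b finite_TT finite_walks by (subst (asm) sum_nonneg_eq_0_iff; simp)+
  then show "T \<in> TT \<Longrightarrow> card {e \<in> walks w. charged w e T} = 2"
    and "e \<in> walks w \<Longrightarrow> card {T \<in> TT. charged w e T} = 1"
    by fastforce+
qed

text \<open>A triple through \<open>w\<close> can only be charged by the walks (x, y) and (y, x). At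
  slack zero both occur, so both are walks and the triple is a triangle.\<close>

lemma slack_0_triple_inside:
  assumes "slack w = 0" "{w, x, y} \<in> TT"
  shows "adj w x \<and> adj w y \<and> adj x y"
proof -
  have "card {w, x, y} = 3" using triple assms(2) by blast
  then have ne: "w \<noteq> x" "w \<noteq> y" "x \<noteq> y"
    by (auto simp: card_insert_if split: if_splits)
  have "card {(x, y), (y, x)} = 2" using ne by simp
  then have "{e \<in> walks w. charged w e {w, x, y}} = {(x, y), (y, x)}"
    using slack_0D(1)[OF assms] charged_inside[OF refl ne] by (intro card_subset_eq) auto
  then have "(x, y) \<in> walks w" "(y, x) \<in> walks w" by auto
  then show ?thesis by (auto simp: walks_def)
qed

text \<open>Since \<open>y\<close> is not adjacent to \<open>w\<close>, the walk
  \<open>w, x, y\<close> is charged to every triple containing \<open>x\<close> and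
  \<open>y\<close>, and slack zero allows only one charge.\<close>

lemma slack_0_unique_triple:
  assumes "slack w = 0" "adj w x" "\<not> adj w y" "y \<noteq> w" "adj x y"
    and "{x, y, p} \<in> TT" "{x, y, p'} \<in> TT"
  shows "p = p'"
proof -
  have xy: "(x, y) \<in> walks w" using assms by (auto simp: walks_def)
  have "\<exists>T. {T \<in> TT. charged w (x, y) T} = {T}"
    using slack_0D(2)[OF assms(1) xy] by (simp add: card_1_singleton_iff)
  moreover have "{x, y, p} \<in> {T \<in> TT. charged w (x, y) T}" "{x, y, p'} \<in> {T \<in> TT. charged w (x, y) T}"
    using assms by (simp_all add: charged_def)
  ultimately have "{x, y, p} = {x, y, p'}" by (metis singletonD)
  moreover have "p \<noteq> x" "p \<noteq> y" "p' \<noteq> x" "p' \<noteq> y"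
    using triple[OF assms(6)] triple[OF assms(7)] by (auto simp: card_insert_if split: if_splits)
  ultimately show ?thesis by blast
qed

text \<open>The two charges are two edges inside \<open>T\<close> that join neighbours of
  \<open>w\<close> to nonneighbours. Disjoint edges would need four vertices, so the edges share an
  end; this is \<open>x\<close>, alone on its side.\<close>

lemma slack_0_triple_outside:
  assumes "slack w = 0" "T \<in> TT" "w \<notin> T"
  shows "\<exists>x y z. T = {x, y, z} \<and> x \<noteq> y \<and> x \<noteq> z \<and> y \<noteq> z \<and> adj x y \<and> adj x z \<and>
    adj w x \<noteq> adj w y \<and> adj w x \<noteq> adj w z"
proof -
  have "card T = 3" using triple[OF assms(2)] by simp
  then obtain a b c where T: "T = {a, b, c}" "a \<noteq> b" "a \<noteq> c" "b \<noteq> c"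
    by (rule card_3_obtain)
  have "card {(x, y). x \<in> T \<and> y \<in> T \<and> adj w x \<and> \<not> adj w y \<and> adj x y} = 2"
    using slack_0D(1)[OF assms(1,2)] charged_outside[OF assms(3)] by simp
  then obtain e e' where e: "{(x, y). x \<in> T \<and> y \<in> T \<and> adj w x \<and> \<not> adj w y \<and> adj x y} = {e, e'}" "e \<noteq> e'"
    unfolding card_2_iff by blast
  obtain x y where xy: "e = (x, y)" by fastforce
  obtain x' y' where xy': "e' = (x', y')" by fastforce
  have 1: "x \<in> T \<and> y \<in> T \<and> adj w x \<and> \<not> adj w y \<and> adj x y"
  proof -
    have "e \<in> {(x, y). x \<in> T \<and> y \<in> T \<and> adj w x \<and> \<not> adj w y \<and> adj x y}" unfolding e by simp
    then show ?thesis unfolding xy by blast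
  qed
  have 2: "x' \<in> T \<and> y' \<in> T \<and> adj w x' \<and> \<not> adj w y' \<and> adj x' y'"
  proof -
    have "e' \<in> {(x, y). x \<in> T \<and> y \<in> T \<and> adj w x \<and> \<not> adj w y \<and> adj x y}" unfolding e by simp
    then show ?thesis unfolding xy' by blast
  qed
  have 3: "x \<noteq> x' \<or> y \<noteq> y'" using e(2) xy xy' by simp
  have ne: "x \<noteq> y" "x' \<noteq> y'" "x \<noteq> y'" "x' \<noteq> y" using 1 2 by auto
  consider "x = x'" "y \<noteq> y'" | "y = y'" "x \<noteq> x'" | "x \<noteq> x'" "y \<noteq> y'" using 3 by blast
  then show ?thesis
  proof cases
    case 1
    then have "T = {x, y, y'}" using T \<open>x \<in> T \<and> _\<close> 2 ne by auto
    then show ?thesis using 1 \<open>x \<in> T \<and> _\<close> 2 ne by blast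
  next
    case c: 2
    then have "T = {y, x, x'}" using T 1 2 ne by auto
    then show ?thesis using c 1 2 ne adj_sym by metis
  next
    case 3
    have "card {x, x', y, y'} = 4" using 3 ne by auto
    moreover have "{x, x', y, y'} \<subseteq> T" using 1 2 by auto
    then have "card {x, x', y, y'} \<le> card T"
      using T(1) by (intro card_mono) auto
    ultimately show ?thesis using \<open>card T = 3\<close> by simp
  qed
qed

text \<open>By \<open>covered\<close> the edge lies in a triple, and at slack zero a triple through
  \<open>w\<close> is a triangle.\<close>

lemma slack_0_not_isolated:
  assumes "slack w = 0" "adj w x"
  shows "\<exists>y. adj w y \<and> adj x y"
  using covered[OF assms(2)] slack_0_triple_inside[OF assms(1)] by blast

lemma slack_0_no_triangle:
  assumes "slack w = 0" "adj x y" "adj y z" "adj x z" "adj w x = adj w y" "adj w x = adj w z"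
    "w \<noteq> x" "w \<noteq> y" "w \<noteq> z"
  shows False
proof -
  have "{x, y, z} \<in> TT" "w \<notin> {x, y, z}" using assms triangle by auto
  from slack_0_triple_outside[OF assms(1) this]
  obtain a b c where *: "{x, y, z} = {a, b, c}" "adj w a \<noteq> adj w b"
    by (elim exE conjE) (rule that)
  have "a \<in> {x, y, z}" "b \<in> {x, y, z}" unfolding *(1) by simp_all
  then show False using *(2) assms(5,6) by auto
qed

text \<open>Each common neighbour of \<open>x\<close> and \<open>y\<close> gives a triple on the
  edge \<open>xy\<close>. The edge joins a neighbour of \<open>w\<close> to a nonneighbour, so it
  lies in only one triple.\<close>

lemma slack_0_unique_common:
  assumes "slack w = 0" "adj w x \<noteq> adj w y" "x \<noteq> w" "y \<noteq> w" "adj x y"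
    and "adj x p" "adj y p" "adj x q" "adj y q"
  shows "p = q"
proof -
  have *: "{x, y, p} \<in> TT" "{x, y, q} \<in> TT"
    using assms triangle[of x y p] triangle[of x y q] by simp_all
  then have **: "{y, x, p} \<in> TT" "{y, x, q} \<in> TT"
    by (simp_all add: insert_commute)
  show ?thesis
  proof (cases "adj w x")
    case True
    then show ?thesis using slack_0_unique_triple[of w x y p q] assms * by blast
  next
    case False
    have "adj y x" using assms(5) adj_sym by blast
    then show ?thesis
      using slack_0_unique_triple[of w y x p q] False assms ** by blast
  qed
qed

text \<open>A vertex without slack separates one vertex from the other two in every triangle that avoids
  it, so two edges with a second common neighbour cannot both occur.\<close>

lemma slack_0_no_fat_triangle:
  assumes "slack w = 0" "w \<noteq> a" "w \<noteq> b" "w \<noteq> c" "adj a b" "adj b c" "adj a c"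
    and "adj a p" "adj b p" "p \<noteq> c" and "adj a q" "adj c q" "q \<noteq> b"
  shows False
proof -
  have "\<not> (adj w a = adj w b \<and> adj w a = adj w c)"
    using slack_0_no_triangle[OF assms(1) assms(5,6,7)] assms(2-4) by blast
  then consider "adj w a \<noteq> adj w b" | "adj w a \<noteq> adj w c"
    by blast
  then show False
  proof cases
    case 1
    then show False
      using slack_0_unique_common[of w a b p c] assms adj_sym[of c b] by (simp add: adj_sym)
  next
    case 2
    then show False
      using slack_0_unique_common[of w a c q b] assms by (simp add: adj_sym)
  qed
qed

end

section \<open>Isomorphisms and double counting\<close>

lemma isomorphicI:
  assumes "bij_betw g (verts K) (verts G)"
    and "\<And>i j. i \<in> verts K \<Longrightarrow> j \<in> verts K \<Longrightarrow> adjacent G (g i) (g j) \<longleftrightarrow> adjacent K i j"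
  shows "isomorphic G K"
proof -
  let ?f = "inv_into (verts K) g"
  have f: "bij_betw ?f (verts G) (verts K)"
    using assms(1) by (rule bij_betw_inv_into)
  have "adjacent G x y \<longleftrightarrow> adjacent K (?f x) (?f y)" if "x \<in> verts G" "y \<in> verts G" for x y
    using assms(2)[of "?f x" "?f y"] that f bij_betw_inv_into_right[OF assms(1)]
    by (metis bij_betwE)
  then show ?thesis
    unfolding isomorphic_def using f by blast
qed

lemma isomorphic_listI:
  assumes "verts K = {1..length vs}" "distinct vs" "set vs = verts G"
    and "\<forall>i<length vs. \<forall>j<length vs. adjacent G (vs ! i) (vs ! j) \<longleftrightarrow> adjacent K (Suc i) (Suc j)"
  shows "isomorphic G K"
proof (rule isomorphicI)
  have "bij_betw (\<lambda>i. i - 1) {1..length vs} {..<length vs}"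
    by (rule bij_betw_byWitness[where f' = Suc]) auto
  moreover have "bij_betw (\<lambda>i. vs ! i) {..<length vs} (set vs)"
    using assms(2) by (rule bij_betw_nth) auto
  ultimately have "bij_betw ((\<lambda>i. vs ! i) \<circ> (\<lambda>i. i - 1)) {1..length vs} (set vs)"
    by (rule bij_betw_trans)
  then show "bij_betw (\<lambda>i. vs ! (i - 1)) (verts K) (verts G)"
    using assms(1,3) by (simp add: comp_def)
  show "adjacent G (vs ! (i - 1)) (vs ! (j - 1)) \<longleftrightarrow> adjacent K i j"
    if "i \<in> verts K" "j \<in> verts K" for i j
    using that assms(1,4) by (cases i; cases j) auto
qed

text \<open>Provides the labels that \<open>Kplus\<close> prescribes on its first part. The
  hypotheses describe a matching with at most one unmatched vertex. The induction removes one
  matched pair at a time, and once no pair is left at most one vertex remains.\<close>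

lemma matching_enumeration:
  fixes U :: "'a set" and R :: "'a \<Rightarrow> 'a \<Rightarrow> bool"
  assumes "finite U" and sym: "\<And>x y. R x y \<Longrightarrow> R y x" and irrefl: "\<And>x. \<not> R x x"
    and "\<And>x y z. x \<in> U \<Longrightarrow> y \<in> U \<Longrightarrow> z \<in> U \<Longrightarrow> R x y \<Longrightarrow> R x z \<Longrightarrow> y = z"
    and "\<And>x y. x \<in> U \<Longrightarrow> y \<in> U \<Longrightarrow> \<forall>z\<in>U. \<not> R x z \<Longrightarrow> \<forall>z\<in>U. \<not> R y z \<Longrightarrow> x = y"
  shows "\<exists>f. bij_betw f U {1..card U} \<and>
    (\<forall>x\<in>U. \<forall>y\<in>U. R x y \<longleftrightarrow> (\<exists>i. 1 \<le> i \<and> i \<le> card U div 2 \<and> {f x, f y} = {2 * i - 1, 2 * i :: nat}))"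
  using assms(1,4,5)
proof (induction "card U" arbitrary: U rule: less_induct)
  case less
  note uniq = less.prems(2) and lone = less.prems(3)
  show ?case
  proof (cases "\<exists>x\<in>U. \<exists>y\<in>U. R x y")
    case False
    have "card U \<le> 1"
    proof (rule ccontr)
      assume "\<not> card U \<le> 1"
      then obtain x y where "x \<in> U" "y \<in> U" "x \<noteq> y"
        using card_le_Suc0_iff_eq[OF less.prems(1)] by auto
      then show False using lone[of x y] False by blast
    qed
    then have "card U div 2 = 0" by simp
    moreover obtain f where "bij_betw f U {1..card U}"
      using ex_bij_betw_finite_nat[OF less.prems(1)] bij_betw_trans
        ex_bij_betw_nat_finite_1[OF less.prems(1)] bij_betw_inv by blast
    ultimately show ?thesis using False by (intro exI[of _ f]) auto
  next
    case True
    then obtain x y where xy: "x \<in> U" "y \<in> U" "R x y" by blast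
    then have "x \<noteq> y" using irrefl by blast
    let ?U = "U - {x, y}"
    have cardU: "card U = card ?U + 2"
      using xy \<open>x \<noteq> y\<close> less.prems(1) card_mono[of U "{x, y}"] by (simp add: card_Diff_subset)
    have noR: "\<not> R x z" "\<not> R y z" "\<not> R z x" "\<not> R z y" if "z \<in> ?U" for z
      using uniq[of x y z] uniq[of y x z] xy that sym by blast+
    have IH: "\<exists>f. bij_betw f ?U {1..card ?U} \<and>
      (\<forall>x\<in>?U. \<forall>y\<in>?U. R x y \<longleftrightarrow>
        (\<exists>i. 1 \<le> i \<and> i \<le> card ?U div 2 \<and> {f x, f y} = {2 * i - 1, 2 * i}))"
    proof (rule less.hyps)
      show "card ?U < card U" using cardU by simp
      show "finite ?U" using less.prems(1) by simp
      show "v = w" if "u \<in> ?U" "v \<in> ?U" "w \<in> ?U" "R u v" "R u w" for u v w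
        using uniq[of u v w] that by blast
      show "u = v" if "u \<in> ?U" "v \<in> ?U" "\<forall>z\<in>?U. \<not> R u z" "\<forall>z\<in>?U. \<not> R v z" for u v
        using lone[of u v] noR[OF that(1)] noR[OF that(2)] that by blast
    qed
    then obtain f where f: "bij_betw f ?U {1..card ?U}"
      and fR: "\<And>u v. u \<in> ?U \<Longrightarrow> v \<in> ?U \<Longrightarrow> R u v \<longleftrightarrow>
        (\<exists>i. 1 \<le> i \<and> i \<le> card ?U div 2 \<and> {f u, f v} = {2 * i - 1, 2 * i})"
      by auto
    \<comment> \<open>The removed pair takes the labels 1 and 2. Shifting the others by 2 carries
      each block {2i - 1, 2i} to the next one, so an unmatched vertex keeps the largest
      label.\<close>
    define h where "h z = (if z = x then 1 else if z = y then 2 else f z + 2)" for z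
    have fge: "1 \<le> f z" "f z \<le> card ?U" if "z \<in> ?U" for z
      using f that by (auto dest!: bij_betwE)
    have hU: "h z = f z + 2" if "z \<in> ?U" for z
      using that by (simp add: h_def)
    have hxy: "h x = 1" "h y = 2" using \<open>x \<noteq> y\<close> by (simp_all add: h_def)
    have "bij_betw h U {1..card U}"
    proof -
      have "bij_betw (\<lambda>m. m + 2) {1..card ?U} {3..card U}"
        unfolding cardU by (rule bij_betw_byWitness[where f' = "\<lambda>m. m - 2"]) auto
      with f have "bij_betw ((\<lambda>m. m + 2) \<circ> f) ?U {3..card U}"
        by (rule bij_betw_trans)
      then have 1: "bij_betw h ?U {3..card U}"
        by (rule bij_betw_cong[THEN iffD1, rotated]) (simp add: hU)
      have 2: "bij_betw h {x, y} {1, 2}"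
        using hxy \<open>x \<noteq> y\<close> by (simp add: bij_betw_def)
      have "bij_betw h (?U \<union> {x, y}) ({3..card U} \<union> {1, 2})"
        using 1 2 by (rule bij_betw_combine) auto
      moreover have "?U \<union> {x, y} = U" "{3..card U} \<union> {1, 2} = {1..card U}"
        using xy cardU by auto
      ultimately show ?thesis by simp
    qed
    moreover have "R u v \<longleftrightarrow> (\<exists>i. 1 \<le> i \<and> i \<le> card U div 2 \<and> {h u, h v} = {2 * i - 1, 2 * i})"
      if uv: "u \<in> U" "v \<in> U" for u v
    proof -
      consider "u \<in> {x, y}" "v \<in> {x, y}" | "u \<in> {x, y}" "v \<in> ?U" | "u \<in> ?U" "v \<in> {x, y}"
        | "u \<in> ?U" "v \<in> ?U" using uv by blast
      then show ?thesis
      proof cases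
        case 1
        have ex: "\<exists>i. 1 \<le> i \<and> i \<le> card U div 2 \<and> {1, 2} = {2 * i - 1, 2 * i}"
          using cardU by (intro exI[of _ 1]) auto
        have "\<not> (\<exists>i. 1 \<le> i \<and> i \<le> card U div 2 \<and> {c, c} = {2 * i - 1, 2 * i})" for c :: nat
          by auto
        with ex 1 show ?thesis
          using hxy xy(3) sym[OF xy(3)] irrefl by (auto simp: insert_commute)
      next
        case 2
        have "h u \<le> 2" "h v \<ge> 3" using 2 hxy hU[OF 2(2)] fge[OF 2(2)] by auto
        then have "\<not> (\<exists>i. 1 \<le> i \<and> i \<le> card U div 2 \<and> {h u, h v} = {2 * i - 1, 2 * i})"
          by (auto simp: doubleton_eq_iff) arith+
        then show ?thesis using 2 noR[OF 2(2)] by auto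
      next
        case 3
        have "h v \<le> 2" "h u \<ge> 3" using 3 hxy hU[OF 3(1)] fge[OF 3(1)] by auto
        then have "\<not> (\<exists>i. 1 \<le> i \<and> i \<le> card U div 2 \<and> {h u, h v} = {2 * i - 1, 2 * i})"
          by (auto simp: doubleton_eq_iff) arith+
        then show ?thesis using 3 noR[OF 3(1)] by auto
      next
        case 4
        have "(\<exists>i. 1 \<le> i \<and> i \<le> card ?U div 2 \<and> {f u, f v} = {2 * i - 1, 2 * i}) \<longleftrightarrow>
          (\<exists>i. 1 \<le> i \<and> i \<le> card U div 2 \<and> {f u + 2, f v + 2} = {2 * i - 1, 2 * i})" (is "?l \<longleftrightarrow> ?r")
        proof
          assume ?l
          then obtain i where i: "1 \<le> i" "i \<le> card ?U div 2" "{f u, f v} = {2 * i - 1, 2 * i}" by blast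
          from i(3) have "f u + 2 = 2 * Suc i - 1 \<and> f v + 2 = 2 * Suc i \<or>
              f u + 2 = 2 * Suc i \<and> f v + 2 = 2 * Suc i - 1"
            using i(1) unfolding doubleton_eq_iff by arith
          then have "{f u + 2, f v + 2} = {2 * Suc i - 1, 2 * Suc i}"
            by (simp only: doubleton_eq_iff)
          moreover have "Suc i \<le> card U div 2" using i(2) cardU by simp
          ultimately show ?r by (intro exI[of _ "Suc i"]) simp
        next
          assume ?r
          then obtain i where i: "1 \<le> i" "i \<le> card U div 2" "{f u + 2, f v + 2} = {2 * i - 1, 2 * i}" by blast
          \<comment> \<open>The shifted labels are at least 3, which rules out the block with
            \<open>i = 1\<close> and lets the index be lowered.\<close>
          from i(1,3) have "i \<ge> 2" "f u = 2 * (i - 1) - 1 \<and> f v = 2 * (i - 1) \<or>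
              f u = 2 * (i - 1) \<and> f v = 2 * (i - 1) - 1"
            using fge(1)[OF 4(1)] fge(1)[OF 4(2)] unfolding doubleton_eq_iff by arith+
          moreover from this have "{f u, f v} = {2 * (i - 1) - 1, 2 * (i - 1)}"
            by (simp only: doubleton_eq_iff)
          moreover have "i - 1 \<le> card ?U div 2" using i(2) cardU by simp
          ultimately show ?l by (intro exI[of _ "i - 1"]) simp
        qed
        then show ?thesis
          using fR[OF 4] by (simp add: hU[OF 4(1)] hU[OF 4(2)])
      qed
    qed
    ultimately show ?thesis by blast
  qed
qed

text \<open>In the enumeration of an odd set the vertex with label \<open>card U\<close> would need
  a partner with label \<open>card U + 1\<close>, beyond the range of blocks.\<close>

lemma even_card_matching:
  fixes U :: "'a set" and R :: "'a \<Rightarrow> 'a \<Rightarrow> bool"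
  assumes "finite U" and sym: "\<And>x y. R x y \<Longrightarrow> R y x" and irrefl: "\<And>x. \<not> R x x"
    and ex1: "\<And>x. x \<in> U \<Longrightarrow> \<exists>!y. y \<in> U \<and> R x y"
  shows "even (card U)"
proof (rule ccontr)
  assume odd: "odd (card U)"
  have "\<exists>f. bij_betw f U {1..card U} \<and>
    (\<forall>x\<in>U. \<forall>y\<in>U. R x y \<longleftrightarrow> (\<exists>i. 1 \<le> i \<and> i \<le> card U div 2 \<and> {f x, f y} = {2 * i - 1, 2 * i :: nat}))"
  proof (rule matching_enumeration)
    show "R x y \<Longrightarrow> R y x" for x y by (rule sym)
  qed (use assms(1,3) ex1 in blast)+
  then obtain f where f: "bij_betw f U {1..card U}"
    and R: "\<And>x y. x \<in> U \<Longrightarrow> y \<in> U \<Longrightarrow> R x y \<longleftrightarrow>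
      (\<exists>i. 1 \<le> i \<and> i \<le> card U div 2 \<and> {f x, f y} = {2 * i - 1, 2 * i})" by blast
  have "card U \<in> {1..card U}" using odd by (cases "card U") auto
  then obtain x where x: "x \<in> U" "f x = card U"
    using f by (metis bij_betw_def imageE)
  obtain y where y: "y \<in> U" "R x y" using ex1[OF x(1)] by blast
  then obtain i where "i \<le> card U div 2" "{card U, f y} = {2 * i - 1, 2 * i}" "i \<ge> 1"
    using R[OF x(1) y(1)] x(2) by auto
  then show False using odd
    by (auto simp: doubleton_eq_iff elim!: oddE) presburger+
qed

context triple_cover
begin

text \<open>A description of \<open>Kplus\<close> without labels: \<open>U1\<close> and
  \<open>U2\<close> say that \<open>U\<close> carries a matching with at most one unmatched vertex.
  The numbering comes from \<open>matching_enumeration\<close> on \<open>U\<close> and is arbitrary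
  on \<open>I\<close>.\<close>

lemma isomorphic_Kplus:
  assumes V: "V = U \<union> I" "U \<inter> I = {}"
    and I: "\<And>x y. x \<in> I \<Longrightarrow> y \<in> I \<Longrightarrow> \<not> adj x y"
    and UI: "\<And>x y. x \<in> U \<Longrightarrow> y \<in> I \<Longrightarrow> adj x y"
    and U1: "\<And>x y z. x \<in> U \<Longrightarrow> y \<in> U \<Longrightarrow> z \<in> U \<Longrightarrow> adj x y \<Longrightarrow> adj x z \<Longrightarrow> y = z"
    and U2: "\<And>x y. x \<in> U \<Longrightarrow> y \<in> U \<Longrightarrow> \<forall>z\<in>U. \<not> adj x z \<Longrightarrow> \<forall>z\<in>U. \<not> adj y z \<Longrightarrow> x = y"
  shows "isomorphic H (Kplus (card U) (card I))"
proof -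
  have fin: "finite U" "finite I" using V finite_verts by auto
  let ?s = "card U" and ?t = "card I"
  have "\<exists>f. bij_betw f U {1..?s} \<and> (\<forall>x\<in>U. \<forall>y\<in>U. adj x y \<longleftrightarrow>
      (\<exists>i. 1 \<le> i \<and> i \<le> ?s div 2 \<and> {f x, f y} = {2 * i - 1, 2 * i :: nat}))"
  proof (rule matching_enumeration)
    show "adj x y \<Longrightarrow> adj y x" for x y using adj_sym by blast
  qed (use fin U1 U2 not_adj_self in blast)+
  then obtain f where f: "bij_betw f U {1..?s}"
    and fR: "\<And>x y. x \<in> U \<Longrightarrow> y \<in> U \<Longrightarrow> adj x y \<longleftrightarrow>
      (\<exists>i. 1 \<le> i \<and> i \<le> ?s div 2 \<and> {f x, f y} = {2 * i - 1, 2 * i})" by blast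
  have "card I = card {?s + 1..?s + ?t}" by simp
  then obtain k where k: "bij_betw k I {?s + 1..?s + ?t}"
    using finite_same_card_bij[OF fin(2), of "{?s + 1..?s + ?t}"] by blast
  define h where "h z = (if z \<in> U then f z else k z)" for z
  have hU: "h z = f z" "1 \<le> f z" "f z \<le> ?s" if "z \<in> U" for z
    using that bij_betwE[OF f] by (auto simp: h_def)
  have hI: "h z = k z" "?s + 1 \<le> k z" "k z \<le> ?s + ?t" if "z \<in> I" for z
    using that bij_betwE[OF k] V(2) by (auto simp: h_def)
  have "bij_betw h U {1..?s}"
    using f by (rule bij_betw_cong[THEN iffD1, rotated]) (simp add: hU)
  moreover have "bij_betw h I {?s + 1..?s + ?t}"
    using k by (rule bij_betw_cong[THEN iffD1, rotated]) (simp add: hI)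
  ultimately have "bij_betw h (U \<union> I) ({1..?s} \<union> {?s + 1..?s + ?t})"
    by (rule bij_betw_combine) auto
  moreover have "{1..?s} \<union> {?s + 1..?s + ?t} = {1..?s + ?t}" by auto
  ultimately have bij: "bij_betw h V {1..?s + ?t}" using V by simp
  have Kadj: "adjacent (Kplus ?s ?t) a b \<longleftrightarrow>
      (\<exists>i. 1 \<le> i \<and> i \<le> ?s div 2 \<and> {a, b} = {2 * i - 1, 2 * i}) \<or>
      (a \<in> {1..?s} \<and> b \<in> {?s + 1..?s + ?t}) \<or> (b \<in> {1..?s} \<and> a \<in> {?s + 1..?s + ?t})" for a b
  proof -
    have "{a, b} \<in> {{u, v} | u v. P u \<and> Q v} \<longleftrightarrow> P a \<and> Q b \<or> P b \<and> Q a" for P Q :: "nat \<Rightarrow> bool"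
      by (auto simp: doubleton_eq_iff)
    then have "{a, b} \<in> {{u, v} | u v. u \<in> {1..?s} \<and> v \<in> {?s + 1..?s + ?t}} \<longleftrightarrow>
        (a \<in> {1..?s} \<and> b \<in> {?s + 1..?s + ?t}) \<or> (b \<in> {1..?s} \<and> a \<in> {?s + 1..?s + ?t})" .
    moreover have "{a, b} \<in> {{2 * i - 1, 2 * i} | i. 1 \<le> i \<and> i \<le> ?s div 2} \<longleftrightarrow>
        (\<exists>i. 1 \<le> i \<and> i \<le> ?s div 2 \<and> {a, b} = {2 * i - 1, 2 * i})"
      by blast
    ultimately show ?thesis
      unfolding adjacent_def Kplus_def by simp
  qed
  have small: "\<not> (\<exists>i. 1 \<le> i \<and> i \<le> ?s div 2 \<and> {a, b} = {2 * i - 1, 2 * i})" if "a > ?s \<or> b > ?s" for a b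
    using that by (auto simp: doubleton_eq_iff)
  have "adj x y \<longleftrightarrow> adjacent (Kplus ?s ?t) (h x) (h y)" if "x \<in> V" "y \<in> V" for x y
  proof -
    have "x \<in> U \<or> x \<in> I" "y \<in> U \<or> y \<in> I" using that V(1) by simp_all
    then consider "x \<in> U" "y \<in> U" | "x \<in> U" "y \<in> I" | "x \<in> I" "y \<in> U" | "x \<in> I" "y \<in> I"
      by blast
    then show ?thesis
    proof cases
      case 1
      then show ?thesis using fR[OF 1] hU[OF 1(1)] hU[OF 1(2)] unfolding Kadj by simp
    next
      case 2
      then show ?thesis using UI[OF 2] hU[OF 2(1)] hI[OF 2(2)] unfolding Kadj by simp
    next
      case 3
      then have "adj x y" using UI[of y x] adj_sym by blast
      then show ?thesis using hI[OF 3(1)] hU[OF 3(2)] unfolding Kadj by simp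
    next
      case 4
      have "\<not> adjacent (Kplus ?s ?t) (h x) (h y)"
        using hI[OF 4(1)] hI[OF 4(2)] small[of "h x" "h y"] unfolding Kadj by simp
      then show ?thesis using I[OF 4] by blast
    qed
  qed
  then show ?thesis
    unfolding isomorphic_def using bij by (auto simp: Kplus_def)
qed

section \<open>Degree sums and the total slack\<close>

lemma d_eq_card_edges: "d v = int (card {e \<in> edges H. v \<in> e})"
proof -
  have "inj_on (\<lambda>u. {v, u}) (N v)"
    by (rule inj_onI) (auto simp: doubleton_eq_iff)
  moreover have "(\<lambda>u. {v, u}) ` N v = {e \<in> edges H. v \<in> e}"
  proof (intro equalityI subsetI)
    fix e assume "e \<in> {e \<in> edges H. v \<in> e}"
    then have e: "e \<in> edges H" "v \<in> e" "card e = 2"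
      using simple by (auto simp: simple_graph_def)
    then obtain a b where "e = {a, b}" unfolding card_2_iff by blast
    then have "\<exists>u. e = {v, u}" using e(2) by auto
    then show "e \<in> (\<lambda>u. {v, u}) ` N v"
      using e(1) by (auto simp: adjacent_def)
  qed (auto simp: adjacent_def)
  ultimately show ?thesis
    unfolding d_def by (metis card_image)
qed

lemma finite_edges: "finite (edges H)"
  by (rule finite_subset[of _ "Pow V"]) (use simple finite_verts in \<open>auto simp: simple_graph_def\<close>)

lemma handshake: "(\<Sum>v\<in>V. d v) = 2 * int (card (edges H))"
proof -
  have "(\<Sum>v\<in>V. d v) = (\<Sum>v\<in>V. \<Sum>e\<in>{e \<in> edges H. v \<in> e}. 1)"
    by (simp add: d_eq_card_edges)
  also have "\<dots> = (\<Sum>e\<in>edges H. \<Sum>v\<in>{v \<in> V. v \<in> e}. 1)"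
    by (rule sum.swap_restrict[OF finite_verts finite_edges])
  also have "\<dots> = (\<Sum>e\<in>edges H. 2)"
  proof (rule sum.cong)
    fix e assume "e \<in> edges H"
    then have "e \<subseteq> V" "card e = 2" using simple by (auto simp: simple_graph_def)
    moreover from this have "{v \<in> V. v \<in> e} = e" by blast
    ultimately show "(\<Sum>v\<in>{v \<in> V. v \<in> e}. 1) = (2 :: int)" by simp
  qed simp
  finally show ?thesis by simp
qed

lemma sum_sum_N: "(\<Sum>w\<in>V. \<Sum>x\<in>N w. f x) = (\<Sum>x\<in>V. d x * f x)" for f :: "'a \<Rightarrow> int"
proof -
  have N: "N w = {x \<in> V. adj w x}" for w
    using adj_verts by auto
  have "(\<Sum>w\<in>V. \<Sum>x\<in>N w. f x) = (\<Sum>x\<in>V. \<Sum>w\<in>{w \<in> V. adj w x}. f x)"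
    unfolding N by (rule sum.swap_restrict[OF finite_verts finite_verts])
  also have "\<dots> = (\<Sum>x\<in>V. d x * f x)"
  proof (rule sum.cong)
    fix x
    have "{w \<in> V. adj w x} = N x" unfolding N using adj_sym by blast
    then show "(\<Sum>w\<in>{w \<in> V. adj w x}. f x) = d x * f x" by (simp add: d_def)
  qed simp
  finally show ?thesis .
qed

lemma sum_slack:
  "(\<Sum>w\<in>V. slack w) = 2 * int (card V) * int (card TT) - (\<Sum>x\<in>V. d x * (d x - 1))"
  unfolding slack_def by (simp only: sum_subtractf[of "\<lambda>_. 2 * int (card TT)"] sum_sum_N) simp

end

locale extremal_cover = triple_cover +
  assumes edge_count: "int (card (edges H)) - int (card TT) = (int (card (verts H)) + 1)\<^sup>2 div 8"
begin

text \<open>Expanding the squares, the terms \<open>d w * (d w - 1)\<close> cancel against the total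
  slack, and the handshake lemma leaves n ((n + 1)^2 - 8 (|E| - |T|)), where n is the order. The
  residue of (n + 1)^2 modulo 8 is 1 for even n, 0 for n congruent to 3 and 4 for n congruent to 1
  modulo 4; these are the three regimes treated below.\<close>

lemma sum_deviation:
  "(\<Sum>w\<in>V. (2 * d w - (int (card V) + 1))\<^sup>2 + 4 * slack w) =
    int (card V) * ((int (card V) + 1)\<^sup>2 mod 8)"
proof -
  let ?n = "int (card V)" and ?T = "int (card TT)"
  have sq: "(2 * d w - (?n + 1))\<^sup>2 = 4 * (d w * (d w - 1)) - 4 * ?n * d w + (?n + 1)\<^sup>2" for w
    by (simp add: power2_eq_square algebra_simps)
  have "(\<Sum>w\<in>V. (2 * d w - (?n + 1))\<^sup>2 + 4 * slack w) =
      4 * (\<Sum>w\<in>V. d w * (d w - 1)) - 4 * ?n * (\<Sum>w\<in>V. d w) + ?n * (?n + 1)\<^sup>2 + 4 * (\<Sum>w\<in>V. slack w)"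
    unfolding sq by (simp add: sum.distrib sum_subtractf sum_distrib_left)
  also have "\<dots> = ?n * ((?n + 1)\<^sup>2 - 8 * (int (card (edges H)) - ?T))"
    unfolding sum_slack handshake by (simp add: algebra_simps)
  also have "\<dots> = ?n * ((?n + 1)\<^sup>2 mod 8)"
    unfolding edge_count by (simp add: minus_mult_div_eq_mod)
  finally show ?thesis .
qed

end

section \<open>Covers without slack\<close>

context triple_cover
begin

text \<open>Serves to recognise small concrete graphs. The list \<open>rows ! i\<close> holds the
  positions in \<open>vs\<close> of the neighbours of \<open>vs ! i\<close>. Positions start at 0
  and the vertices of \<open>K\<close> at 1, hence \<open>Suc\<close>. The condition on
  \<open>K\<close> concerns numbers only and can be evaluated.\<close>

lemma isomorphic_rowsI:
  assumes "verts K = {1..m}" "length vs = m" "distinct vs" "set vs = V"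
    and K: "list_all (\<lambda>i. list_all (\<lambda>j. adjacent K (Suc i) (Suc j) \<longleftrightarrow> List.member (rows ! i) j)
      [0..<m]) [0..<m]"
    and rows: "list_all (list_all (\<lambda>j. j < m)) rows" "length rows = m"
    and N: "\<forall>i<m. N (vs ! i) = (!) vs ` set (rows ! i)"
  shows "isomorphic H K"
proof (rule isomorphic_listI[OF _ assms(3,4)], unfold assms(2), rule assms(1), intro allI impI)
  fix i j assume ij: "i < m" "j < m"
  have "adj (vs ! i) (vs ! j) \<longleftrightarrow> vs ! j \<in> (!) vs ` set (rows ! i)"
    using N ij(1) by (metis N_iff)
  also have "\<dots> \<longleftrightarrow> j \<in> set (rows ! i)"
  proof
    assume "vs ! j \<in> (!) vs ` set (rows ! i)"
    then obtain k where k: "k \<in> set (rows ! i)" "vs ! j = vs ! k" by blast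
    have "rows ! i \<in> set rows" using ij(1) rows(2) by simp
    then have "k < m" using k(1) rows(1) by (auto simp: list_all_iff)
    then show "j \<in> set (rows ! i)"
      using nth_eq_iff_index_eq[OF assms(3), of j k] ij(2) k assms(2) by simp
  qed blast
  also have "\<dots> \<longleftrightarrow> adjacent K (Suc i) (Suc j)"
    using K ij by (simp add: list_all_iff)
  finally show "adj (vs ! i) (vs ! j) \<longleftrightarrow> adjacent K (Suc i) (Suc j)" .
qed

text \<open>The matching inside \<open>U\<close> is perfect, so this is the graph K^+ with a first
  part of even size, stated without labels.\<close>

definition matched_join :: "'a set \<Rightarrow> 'a set \<Rightarrow> bool" where
  "matched_join U I \<longleftrightarrow> V = U \<union> I \<and> U \<inter> I = {} \<and> (\<forall>x\<in>I. \<forall>y\<in>I. \<not> adj x y) \<and>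
     (\<forall>x\<in>U. \<forall>y\<in>I. adj x y) \<and> (\<forall>x\<in>U. \<exists>!y. y \<in> U \<and> adj x y)"

lemma matched_join_isomorphic:
  assumes "matched_join U I"
  shows "isomorphic H (Kplus (card U) (card I))"
proof (rule isomorphic_Kplus)
  show "V = U \<union> I" "U \<inter> I = {}" using assms by (simp_all add: matched_join_def)
  show "\<And>x y. x \<in> I \<Longrightarrow> y \<in> I \<Longrightarrow> \<not> adj x y" "\<And>x y. x \<in> U \<Longrightarrow> y \<in> I \<Longrightarrow> adj x y"
    using assms by (simp_all add: matched_join_def)
  have *: "\<exists>!y. y \<in> U \<and> adj x y" if "x \<in> U" for x
    using assms that by (simp add: matched_join_def)
  show "\<And>x y z. x \<in> U \<Longrightarrow> y \<in> U \<Longrightarrow> z \<in> U \<Longrightarrow> adj x y \<Longrightarrow> adj x z \<Longrightarrow> y = z"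
    "\<And>x y. x \<in> U \<Longrightarrow> y \<in> U \<Longrightarrow> \<forall>z\<in>U. \<not> adj x z \<Longrightarrow> \<forall>z\<in>U. \<not> adj y z \<Longrightarrow> x = y"
    using * by blast+
qed

lemma matched_join_props:
  assumes "matched_join U I"
  shows "even (card U)" "card V = card U + card I"
    and "x \<in> I \<Longrightarrow> d x = int (card U)" "x \<in> U \<Longrightarrow> d x = int (card I) + 1"
proof -
  have V: "V = U \<union> I" "U \<inter> I = {}" and I: "\<And>x y. x \<in> I \<Longrightarrow> y \<in> I \<Longrightarrow> \<not> adj x y"
    and UI: "\<And>x y. x \<in> U \<Longrightarrow> y \<in> I \<Longrightarrow> adj x y"
    and U: "\<And>x. x \<in> U \<Longrightarrow> \<exists>!y. y \<in> U \<and> adj x y"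
    using assms by (simp_all add: matched_join_def)
  have fin: "finite U" "finite I" using V finite_verts by auto
  show "even (card U)"
  proof (rule even_card_matching[of U adj])
    show "adj x y \<Longrightarrow> adj y x" for x y using adj_sym by blast
  qed (use fin U in simp_all)
  show "card V = card U + card I"
    using V fin card_Un_disjoint by metis
  show "d x = int (card U)" if "x \<in> I"
  proof -
    have "y \<notin> I" if "adj x y" for y using I[OF \<open>x \<in> I\<close>] that by blast
    then have "N x \<subseteq> U" using N_subset[of x] unfolding V(1) by auto
    moreover have "U \<subseteq> N x" using UI[OF _ that] adj_sym by (meson N_iff subsetI)
    ultimately have "N x = U" by (rule equalityI)
    then show ?thesis by (simp add: d_def)
  qed
  show "d x = int (card I) + 1" if x: "x \<in> U"
  proof -
    obtain y where y: "y \<in> U" "adj x y" "\<And>z. z \<in> U \<Longrightarrow> adj x z \<Longrightarrow> z = y"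
      using U[OF x] by blast
    have "N x \<subseteq> insert y I" using y(3) N_subset[of x] unfolding V(1) by auto
    moreover have "insert y I \<subseteq> N x" using y(2) UI[OF x] by auto
    ultimately have "N x = insert y I" by (rule equalityI)
    moreover have "y \<notin> I" using y(1) V(2) by blast
    ultimately show ?thesis using fin by (simp add: d_def)
  qed
qed

text \<open>\<open>I\<close> consists of the common neighbours of \<open>u\<close> and
  \<open>u'\<close>. As the edge \<open>u u'\<close> lies in two triangles, no other vertex can
  distinguish its ends. Each triangle \<open>u u' z\<close> is split 1:2 by every vertex outside it,
  so such a vertex sees \<open>z\<close> exactly when it does not see \<open>u\<close>. Hence
  members of \<open>I\<close>, which see \<open>u\<close>, do not see each other, and every vertex
  outside \<open>I\<close> sees all of \<open>I\<close>.\<close>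

lemma no_slack_thick_edge:
  assumes s0: "\<And>w. w \<in> V \<Longrightarrow> slack w = 0"
    and uu: "adj u u'" "v \<noteq> v'" "adj u v" "adj u' v" "adj u v'" "adj u' v'"
  shows "\<exists>U I. matched_join U I \<and> U \<noteq> {} \<and> I \<noteq> {}"
proof (intro exI conjI)
  let ?I = "{z. adj u z \<and> adj u' z}"
  let ?U = "V - ?I"
  have same: "adj w u = adj w u'" if "w \<in> V" "w \<noteq> u" "w \<noteq> u'" for w
  proof (rule ccontr)
    assume "adj w u \<noteq> adj w u'"
    then have "v = v'"
      using slack_0_unique_common[OF s0[OF that(1)], of u u' v v'] uu that by auto
    then show False using uu by simp
  qed
  have sep: "adj w z \<longleftrightarrow> \<not> adj w u" if "w \<in> V" "w \<noteq> u" "w \<noteq> u'" "w \<noteq> z" "z \<in> ?I" for w z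
  proof (rule ccontr)
    assume *: "\<not> (adj w z \<longleftrightarrow> \<not> adj w u)"
    have "adj u u'" "adj u' z" "adj u z" using uu that by auto
    from slack_0_no_triangle[OF s0[OF that(1)] this] show False
      using * same[OF that(1-3)] that by blast
  qed
  have I: "\<not> adj x y" if "x \<in> ?I" "y \<in> ?I" for x y
  proof
    assume "adj x y"
    moreover have "x \<in> V" "x \<noteq> u" "x \<noteq> u'" "adj x u"
      using that adj_verts[of u x] adj_sym[of x u] by auto
    moreover have "x \<noteq> y" using \<open>adj x y\<close> by auto
    ultimately show False using sep[of x y] that by auto
  qed
  have UI: "adj x y" if "x \<in> ?U" "y \<in> ?I" for x y
  proof (cases "x = u \<or> x = u'")
    case True
    then show ?thesis using that by blast
  next
    case False
    then have "\<not> adj x u" using same[of x] that adj_sym[of x] by auto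
    moreover have "x \<noteq> y" using that by blast
    ultimately show ?thesis using sep[of x y] that False by blast
  qed
  have v: "v \<in> ?I" "v' \<in> ?I" using uu by auto
  \<comment> \<open>The triangle on the edge \<open>v x\<close> has its third vertex outside
    \<open>I\<close>, which is a partner for \<open>x\<close>. It is unique because
    \<open>v'\<close> sees \<open>x\<close> but not \<open>v\<close>, so the edge \<open>v x\<close>
    has only one common neighbour.\<close>
  have ex1: "\<exists>!y. y \<in> ?U \<and> adj x y" if x: "x \<in> ?U" for x
  proof -
    have vx: "adj v x" "adj v' x" using UI[OF x] v adj_sym by blast+
    have "v \<in> V" "v' \<in> V" using vx adj_verts by blast+
    obtain y where y: "adj v y" "adj x y"
      using slack_0_not_isolated[OF s0[OF \<open>v \<in> V\<close>] vx(1)] by blast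
    have "y \<in> ?U" using y(1) I[OF v(1)] adj_verts by blast
    moreover have "z = y" if "z \<in> ?U" "adj x z" for z
    proof -
      have "adj v z" using UI[OF that(1) v(1)] adj_sym by blast
      moreover have "\<not> adj v' v" "v' \<noteq> x" "v' \<noteq> v" "adj x v"
        using I[OF v(2) v(1)] x v(2) uu(2) vx(1) adj_sym by blast+
      ultimately show ?thesis
        using slack_0_unique_common[OF s0[OF \<open>v' \<in> V\<close>], of x v z y] vx y that(2) by simp
    qed
    ultimately show ?thesis using y(2) by blast
  qed
  have "?I \<subseteq> V" using adj_verts by blast
  then have V: "V = ?U \<union> ?I" "?U \<inter> ?I = {}" by blast+
  show "matched_join ?U ?I"
    unfolding matched_join_def
  proof (intro conjI ballI)
    show "V = ?U \<union> ?I" "?U \<inter> ?I = {}" by (fact V)+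
  qed (fact I UI ex1)+
  show "?I \<noteq> {}" using v by blast
  have "u \<in> ?U" using adj_verts[OF uu(1)] by auto
  then show "?U \<noteq> {}" by blast
qed

end

section \<open>Covers without slack in which every edge lies in only one triangle\<close>

locale thin_cover = triple_cover +
  assumes no_slack: "w \<in> verts H \<Longrightarrow> slack w = 0"
    and thin: "adjacent H x y \<Longrightarrow> adjacent H x p \<Longrightarrow> adjacent H y p \<Longrightarrow>
      adjacent H x q \<Longrightarrow> adjacent H y q \<Longrightarrow> p = q"
begin

text \<open>A partner exists because \<open>w\<close> has no slack and is unique by
  \<open>thin\<close>. So the neighbourhood of every vertex induces a perfect matching.\<close>

lemma link_matching:
  assumes "adj w x" shows "\<exists>!y. y \<in> N w \<and> adj x y"
proof -
  have "w \<in> V" using assms adj_verts by blast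
  then show ?thesis
    using slack_0_not_isolated[OF no_slack assms] thin[OF assms] by auto
qed

lemma even_d: "even (d w)"
proof -
  have "even (card (N w))"
  proof (rule even_card_matching[of "N w" adj])
    show "adj x y \<Longrightarrow> adj y x" for x y using adj_sym by blast
  qed (use link_matching in simp_all)
  then show ?thesis by (simp add: d_def)
qed

text \<open>A vertex outside a triangle splits it 1:2, and seeing two of its vertices would give
  their edge a second common neighbour. So it sees exactly one.\<close>

lemma triangle_separates:
  assumes "adj a b" "adj b c" "adj a c" "w \<in> V" "w \<noteq> a" "w \<noteq> b" "w \<noteq> c"
  shows "adj w a \<and> \<not> adj w b \<and> \<not> adj w c \<or> \<not> adj w a \<and> adj w b \<and> \<not> adj w c \<or>
    \<not> adj w a \<and> \<not> adj w b \<and> adj w c"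
proof -
  have "\<not> (adj w a = adj w b \<and> adj w a = adj w c)"
    using slack_0_no_triangle[OF no_slack[OF assms(4)] assms(1-3)] assms by blast
  moreover have "\<not> (adj w a \<and> adj w b)" "\<not> (adj w a \<and> adj w c)" "\<not> (adj w b \<and> adj w c)"
    using thin[OF assms(1), of c w] thin[OF assms(3), of b w] thin[OF assms(2), of a w]
      assms adj_sym[of w] adj_sym[of b a] adj_sym[of c b] adj_sym[of c a] by auto
  ultimately show ?thesis by blast
qed

text \<open>By \<open>triangle_separates\<close> the neighbours of \<open>a\<close>,
  \<open>b\<close> and \<open>c\<close> outside the triangle partition the remaining vertices, so
  the three numbers \<open>d - 2\<close> add up to \<open>card V - 3\<close>.\<close>

lemma triangle_d_sum:
  assumes "adj a b" "adj b c" "adj a c"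
  shows "d a + d b + d c = int (card V) + 3"
proof -
  have ba: "adj b a" "adj c b" "adj c a" using assms adj_sym by blast+
  have ne: "a \<noteq> b" "a \<noteq> c" "b \<noteq> c" using assms by auto
  have abc: "a \<in> V" "b \<in> V" "c \<in> V" using assms adj_verts by blast+
  let ?A = "N a - {b, c}" and ?B = "N b - {a, c}" and ?C = "N c - {a, b}"
  have sep: "w \<in> V \<Longrightarrow> w \<noteq> a \<Longrightarrow> w \<noteq> b \<Longrightarrow> w \<noteq> c \<Longrightarrow>
    adj a w \<and> \<not> adj b w \<and> \<not> adj c w \<or> \<not> adj a w \<and> adj b w \<and> \<not> adj c w \<or>
    \<not> adj a w \<and> \<not> adj b w \<and> adj c w" for w
    using triangle_separates[OF assms, of w] adj_sym[of w] by simp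
  have "V - {a, b, c} \<subseteq> ?A \<union> ?B \<union> ?C"
    using sep unfolding N_def by blast
  moreover have "?A \<union> ?B \<union> ?C \<subseteq> V - {a, b, c}"
    using N_subset by auto
  ultimately have "V - {a, b, c} = ?A \<union> ?B \<union> ?C" by blast
  moreover have "card (?A \<union> ?B \<union> ?C) = card ?A + card ?B + card ?C"
  proof -
    have "w \<notin> ?B" if "w \<in> ?A" for w
      using sep[of w] that N_subset[of a] by (cases "w = a") auto
    moreover have "w \<notin> ?C" if "w \<in> ?A \<union> ?B" for w
      using sep[of w] that N_subset[of a] N_subset[of b] by (cases "w = a \<or> w = b") auto
    ultimately have "?A \<inter> ?B = {}" "(?A \<union> ?B) \<inter> ?C = {}" by blast+
    then show ?thesis by (simp add: card_Un_disjoint)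
  qed
  moreover have "card (V - {a, b, c}) = card V - 3" "card V \<ge> 3"
    using abc ne card_mono[of V "{a, b, c}"] finite_verts by (simp_all add: card_Diff_subset)
  moreover have "card ?A = card (N a) - 2" "card ?B = card (N b) - 2" "card ?C = card (N c) - 2"
    "card (N a) \<ge> 2" "card (N b) \<ge> 2" "card (N c) \<ge> 2"
    using assms ba ne card_mono[of "N a" "{b, c}"] card_mono[of "N b" "{a, c}"]
      card_mono[of "N c" "{a, b}"] by (simp_all add: card_Diff_subset)
  ultimately show ?thesis by (simp add: d_def)
qed

lemma link_pairs:
  assumes "N v = {p, q, r, s}" "distinct [p, q, r, s]" "adj p q"
  shows "adj r s"
proof -
  have v: "adj v p" "adj v q" "adj v r" "adj v s" using assms(1) by (simp_all add: N_def set_eq_iff)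
  obtain y where y: "y \<in> N v" "adj r y" using link_matching[OF v(3)] by blast
  have "adj q p" "adj y r" using assms(3) y(2) adj_sym by blast+
  then have "y \<noteq> p" "y \<noteq> q" "y \<noteq> r"
    using thin[OF v(1), of q r] thin[OF v(2), of p r] v y(2) assms by auto
  then show ?thesis using y assms(1) by auto
qed

lemma card_N_4:
  assumes "d v = 4" "adj v p" "adj v q" "p \<noteq> q"
  obtains r s where "N v = {p, q, r, s}" "distinct [p, q, r, s]"
proof -
  have "card (N v - {p, q}) = 2"
    using assms by (simp add: d_def card_Diff_subset)
  then obtain r s where rs: "N v - {p, q} = {r, s}" "r \<noteq> s" unfolding card_2_iff by blast
  have "{p, q} \<subseteq> N v" using assms(2,3) by simp
  then have "N v = {p, q} \<union> (N v - {p, q})" by blast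
  then have "N v = {p, q, r, s}" unfolding rs(1) Un_insert_left Un_empty_left .
  moreover have "p \<notin> {r, s}" "q \<notin> {r, s}" unfolding rs(1)[symmetric] by simp_all
  then have "distinct [p, q, r, s]" using rs(2) assms(4) by simp
  ultimately show thesis by (rule that)
qed

text \<open>\<open>H9\<close> is the 3 by 3 rook's graph. The two triangles at \<open>w\<close>
  serve as first row \<open>w a a'\<close> and first column \<open>w b b'\<close>. The rules that an
  outside vertex sees exactly one vertex of a triangle and that degrees are 4 then determine the
  other four cells.\<close>

lemma isomorphic_H9:
  assumes "card V = 9" and d4: "\<And>v. v \<in> V \<Longrightarrow> d v = 4"
  shows "isomorphic H H9"
proof -
  have "V \<noteq> {}" using assms(1) by auto
  then obtain w where w: "w \<in> V" by blast
  then have "N w \<noteq> {}" using d4[OF w] by (auto simp: d_def)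
  then obtain a where a: "adj w a" by auto
  obtain a' where a': "adj w a'" "adj a a'" using link_matching[OF a] by auto
  then have "a \<noteq> a'" by auto
  obtain b b' where Nw: "N w = {a, a', b, b'}" and dw: "distinct [a, a', b, b']"
    using card_N_4[OF d4[OF w] a a'(1) \<open>a \<noteq> a'\<close>] by blast
  have bb': "adj b b'" by (rule link_pairs[OF Nw dw a'(2)])
  have inV: "a \<in> V" "a' \<in> V" "b \<in> V" "b' \<in> V"
    using Nw N_subset[of w] by auto
  have wb: "adj w b" "adj w b'" using Nw by (auto simp: set_eq_iff)
  have rev: "adj a w" "adj a' w" "adj b w" "adj b' w" "adj a' a" "adj b' b"
    using a a' wb bb' adj_sym by blast+
  have nab: "\<not> adj a b" "\<not> adj a b'" "\<not> adj a' b" "\<not> adj a' b'"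
    using triangle_separates[OF a a'(2) a'(1), of b] triangle_separates[OF a a'(2) a'(1), of b']
      rev inV dw adj_sym adj_neq[OF wb(1)] adj_neq[OF wb(2)] by auto
  \<comment> \<open>In the second triangle \<open>x y z\<close> at \<open>x\<close>, each of
    \<open>b\<close> and \<open>b'\<close> sees exactly one of \<open>y\<close> and
    \<open>z\<close>. It is not the same one, since \<open>w\<close> is the only common neighbour of
    \<open>b\<close> and \<open>b'\<close>. The names are chosen so that \<open>b\<close> sees
    \<open>y\<close>.\<close>
  have pick: "\<exists>y z. N x = {w, x', y, z} \<and> distinct [w, x', y, z] \<and> adj y z \<and> adj b y \<and> adj b' z"
    if x: "adj w x" "adj w x'" "adj x x'" "adj x w" "x \<in> V" "\<not> adj x b" "\<not> adj x b'" "x \<noteq> b" "x \<noteq> b'"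
      "x' \<noteq> b" "x' \<noteq> b'" for x x'
  proof -
    have "w \<noteq> x'" using x(2) by auto
    then obtain y z where yz: "N x = {w, x', y, z}" "distinct [w, x', y, z]"
      using card_N_4[OF d4[OF x(5)] x(4) x(3)] by blast
    have "adj y z" by (rule link_pairs[OF yz x(2)])
    have xy: "adj x y" "adj x z" using yz(1) by (auto simp: set_eq_iff)
    have V: "y \<in> V" "z \<in> V" using xy adj_verts by blast+
    have nbx: "\<not> adj b x" "\<not> adj b' x" using x(6,7) adj_sym by blast+
    have ynb: "y \<noteq> b" "y \<noteq> b'" "z \<noteq> b" "z \<noteq> b'" using xy x(6,7) by auto
    have b1: "adj b y \<and> \<not> adj b z \<or> \<not> adj b y \<and> adj b z"
      using triangle_separates[OF xy(1) \<open>adj y z\<close> xy(2), of b] nbx inV ynb x(8) by blast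
    have b2: "adj b' y \<and> \<not> adj b' z \<or> \<not> adj b' y \<and> adj b' z"
      using triangle_separates[OF xy(1) \<open>adj y z\<close> xy(2), of b'] nbx inV ynb x(9) by blast
    have no: "\<not> (adj b u \<and> adj b' u)" if "u \<noteq> w" for u
      using thin[OF bb', of w u] rev that by auto
    show ?thesis
    proof (cases "adj b y")
      case True
      then have "adj b' z" using b2 no[of y] yz(2) by auto
      then show ?thesis using True yz \<open>adj y z\<close> by blast
    next
      case False
      then have "adj b z" "adj b' y" using b1 b2 no[of z] yz(2) by auto
      moreover have "N x = {w, x', z, y}" "distinct [w, x', z, y]" using yz by auto
      ultimately show ?thesis using \<open>adj y z\<close> adj_sym by blast
    qed
  qed
  have ne: "a \<noteq> b" "a \<noteq> b'" "a' \<noteq> b" "a' \<noteq> b'" using dw by auto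
  obtain y z where y: "N a = {w, a', y, z}" "distinct [w, a', y, z]" "adj y z" "adj b y" "adj b' z"
    using pick[of a a'] a a' rev inV nab ne by blast
  obtain y' z' where y': "N a' = {w, a, y', z'}" "distinct [w, a, y', z']" "adj y' z'" "adj b y'" "adj b' z'"
    using pick[of a' a] a a' rev inV nab ne by blast
  have ay: "adj a y" "adj a z" "adj a' y'" "adj a' z'"
    using y(1) y'(1) by (auto simp: set_eq_iff)
  have cross: "u \<noteq> u'" if "adj a u" "adj a' u'" "u \<noteq> w" for u u'
    using thin[OF a'(2), of w u] rev that by auto
  have ne2: "y \<noteq> y'" "y \<noteq> z'" "z \<noteq> y'" "z \<noteq> z'"
    using cross ay y(2) by auto
  have notin: "u \<noteq> b \<and> u \<noteq> b'" if "adj a u \<or> adj a' u" for u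
    using that nab by blast
  have ne3: "y \<noteq> b" "y \<noteq> b'" "z \<noteq> b" "z \<noteq> b'" "y' \<noteq> b" "y' \<noteq> b'" "z' \<noteq> b" "z' \<noteq> b'"
    "y \<noteq> a" "z \<noteq> a" "y' \<noteq> a'" "z' \<noteq> a'"
    using notin[of y] notin[of z] notin[of y'] notin[of z'] ay by auto
  have wne: "w \<noteq> a" "w \<noteq> a'" "w \<noteq> b" "w \<noteq> b'" using a a' wb by auto
  \<comment> \<open>The grid has rows \<open>w a a'\<close>, \<open>b y y'\<close> and
    \<open>b' z z'\<close>. In \<open>H9\<close> the corresponding rows are 1 2 5, 6 3 4 and 9 7 8,
    which gives this order.\<close>
  let ?vs = "[w, a, y, y', a', b, z, z', b']"
  have dist: "distinct ?vs"
    using dw y(2) y'(2) ne2 ne3 wne by auto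
  have full: "N v = {p, q, r, s}" if "v \<in> V" "adj v p" "adj v q" "adj v r" "adj v s" "distinct [p, q, r, s]"
    for v p q r s
  proof -
    have "card {p, q, r, s} = 4" using that(6) by simp
    moreover have "card (N v) = 4" using d4[OF that(1)] by (simp add: d_def)
    moreover have "{p, q, r, s} \<subseteq> N v" using that by simp
    ultimately show ?thesis using card_subset_eq[OF finite_N] by metis
  qed
  have Nb: "N b = {w, b', y, y'}" using full[of b w b' y y'] inV rev bb' y(4) y'(4) dist by auto
  have Nb': "N b' = {w, b, z, z'}" using full[of b' w b z z'] inV rev y(5) y'(5) dist by auto
  have yy': "adj y y'"
    by (rule link_pairs[OF Nb]) (use dist wb in auto)
  have zz': "adj z z'"
    by (rule link_pairs[OF Nb']) (use dist wb in auto)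
  have V4: "y \<in> V" "z \<in> V" "y' \<in> V" "z' \<in> V" using ay adj_verts by blast+
  have rev2: "adj y a" "adj z a" "adj y' a'" "adj z' a'" "adj y b" "adj z b'" "adj y' b" "adj z' b'"
    "adj z y" "adj z' y'" "adj y' y" "adj z' z"
    using ay y y' yy' zz' adj_sym by blast+
  have Ny: "N y = {a, z, b, y'}" using full[of y a z b y'] V4 rev2 y(3) yy' dist by auto
  have Nz: "N z = {a, y, b', z'}" using full[of z a y b' z'] V4 rev2 zz' dist by auto
  have Ny': "N y' = {a', z', b, y}" using full[of y' a' z' b y] V4 rev2 y'(3) dist by auto
  have Nz': "N z' = {a', y', b', z}" using full[of z' a' y' b' z] V4 rev2 dist by auto
  show ?thesis
  proof (rule isomorphic_rowsI[of _ 9 ?vs, OF _ _ dist])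
    let ?rows = "[[1,4,5,8],[0,2,4,6],[1,3,5,6],[2,4,5,7],[0,1,3,7],[0,2,3,8],[1,2,7,8],[3,4,6,8],[0,5,6,7]] :: nat list list"
    show "verts H9 = {1..9}" by (simp add: H9_def)
    show "length ?vs = 9" by simp
    have "set ?vs \<subseteq> V" using w inV V4 by simp
    moreover have "card (set ?vs) = 9" using distinct_card[OF dist] by simp
    ultimately show "set ?vs = V" using card_subset_eq[OF finite_verts] assms(1) by metis
    show "list_all (\<lambda>i. list_all (\<lambda>j. adjacent H9 (Suc i) (Suc j) \<longleftrightarrow> List.member (?rows ! i) j)
        [0..<9]) [0..<9]"
      by code_simp
    show "list_all (list_all (\<lambda>j. j < 9)) ?rows" "length ?rows = 9"
      by simp_all
    have less9: "(\<forall>i<9. P i) \<longleftrightarrow> P 0 \<and> P 1 \<and> P 2 \<and> P 3 \<and> P 4 \<and> P 5 \<and> P 6 \<and> P 7 \<and> P 8"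
      for P :: "nat \<Rightarrow> bool"
    proof -
      have *: "{..<9} = {0, 1, 2, 3, 4, 5, 6, 7, 8 :: nat}" by auto
      have "(\<forall>i<9. P i) \<longleftrightarrow> (\<forall>i\<in>{..<9}. P i)"
        by (simp only: Ball_def lessThan_iff)
      then show ?thesis unfolding * by simp
    qed
    show "\<forall>i<9. N (?vs ! i) = (!) ?vs ` set (?rows ! i)"
      unfolding less9 using Nw y(1) y'(1) Nb Nb' Ny Nz Ny' Nz' by (simp add: insert_commute)
  qed
qed

end

section \<open>Orders not congruent to 1 modulo 4\<close>

text \<open>Turns an identity for the sum over all vertices into one for each vertex, whenever the
  sum is at most the total of the pointwise lower bounds.\<close>

lemma sum_eq_lower_bound:
  fixes f :: "'b \<Rightarrow> int"
  assumes "finite A" "\<And>x. x \<in> A \<Longrightarrow> c \<le> f x" "sum f A \<le> int (card A) * c" "x \<in> A"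
  shows "f x = c"
proof -
  have "(\<Sum>x\<in>A. f x - c) \<le> 0" using assms(3) by (simp add: sum_subtractf)
  moreover have "(\<Sum>x\<in>A. f x - c) \<ge> 0" by (rule sum_nonneg) (use assms(2) in force)
  ultimately have "(\<Sum>x\<in>A. f x - c) = 0" by linarith
  then have "\<forall>x\<in>A. f x - c = 0"
    by (subst (asm) sum_nonneg_eq_0_iff) (use assms(1,2) in auto)
  then show ?thesis using assms(4) by simp
qed

context triple_cover
begin

text \<open>The dichotomy is whether some edge has two common neighbours: if so,
  \<open>no_slack_thick_edge\<close> gives the join structure, and if not, the cover is
  thin.\<close>

lemma no_slack_cases:
  assumes s0: "\<And>w. w \<in> V \<Longrightarrow> slack w = 0"
  shows "(\<exists>U I. matched_join U I \<and> U \<noteq> {} \<and> I \<noteq> {}) \<or> thin_cover H TT"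
proof (cases "\<exists>u u' v v'. adj u u' \<and> v \<noteq> v' \<and> adj u v \<and> adj u' v \<and> adj u v' \<and> adj u' v'")
  case True
  then show ?thesis using no_slack_thick_edge[OF s0] by blast
next
  case False
  have "thin_cover H TT"
  proof
    show "slack w = 0" if "w \<in> V" for w using s0[OF that] .
    show "p = q" if "adj x y" "adj x p" "adj y p" "adj x q" "adj y q" for x y p q
      using False that by blast
  qed
  then show ?thesis by blast
qed

lemma d_pos_triangle:
  assumes "slack w = 0" "d w > 0"
  obtains a b where "adj w a" "adj a b" "adj w b"
proof -
  have "N w \<noteq> {}" using assms(2) by (auto simp: d_def)
  then obtain a where "adj w a" by auto
  then show thesis using slack_0_not_isolated[OF assms(1)] that by blast
qed

lemma card_N_inter_split:
  assumes "A \<subseteq> V" shows "card (N v) = card (N v \<inter> A) + card (N v \<inter> (V - A))"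
proof -
  have "N v = (N v \<inter> A) \<union> (N v \<inter> (V - A))" using N_subset[of v] by blast
  moreover have "card ((N v \<inter> A) \<union> (N v \<inter> (V - A))) = card (N v \<inter> A) + card (N v \<inter> (V - A))"
    by (intro card_Un_disjoint) auto
  ultimately show ?thesis by metis
qed

text \<open>Since \<open>p\<close> sees all of \<open>Q\<close> and has no slack, \<open>Q\<close>
  induces a graph without triangles and without isolated vertices. On four vertices these are the
  star, two disjoint edges, the 4-cycle and the path; joined to \<open>p\<close> they give
  \<open>Kplus 2 3\<close>, \<open>Kplus 4 1\<close>, \<open>H5b\<close> and
  \<open>H5a\<close>.\<close>

lemma wheel_cases:
  assumes p: "slack p = 0" "N p = Q" and V: "V = insert p Q" "card Q = 4"
  shows "isomorphic H H5a \<or> isomorphic H H5b \<or> isomorphic H (Kplus 2 3) \<or> isomorphic H (Kplus 4 1)"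
proof -
  have pQ: "p \<notin> Q" using p(2) by auto
  have padj: "adj p x" "adj x p" if "x \<in> Q" for x
    using that p(2) adj_sym[of p x] by auto
  have finQ: "finite Q" using V(2) card.infinite by fastforce
  have notri: False if "x \<in> Q" "y \<in> Q" "z \<in> Q" "adj x y" "adj y z" "adj x z" for x y z
    using slack_0_no_triangle[OF p(1) that(4-6)] padj that pQ by blast
  have ex: "\<exists>y\<in>Q. adj x y" if "x \<in> Q" for x
    using slack_0_not_isolated[OF p(1) padj(1)[OF that]] p(2) by auto
  have NQ: "N x \<subseteq> insert p Q" for x using N_subset V(1) by blast
  show ?thesis
  proof (cases "\<exists>x\<in>Q. \<forall>y\<in>Q. y \<noteq> x \<longrightarrow> adj x y")
    case True
    then obtain x where x: "x \<in> Q" "\<And>y. y \<in> Q \<Longrightarrow> y \<noteq> x \<Longrightarrow> adj x y" by blast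
    have "matched_join {p, x} (Q - {x})"
      unfolding matched_join_def
    proof (intro conjI ballI)
      show "V = {p, x} \<union> (Q - {x})" using V(1) x(1) by blast
      show "{p, x} \<inter> (Q - {x}) = {}" using pQ by blast
      show "\<not> adj y z" if "y \<in> Q - {x}" "z \<in> Q - {x}" for y z
        using notri[of x y z] x that by blast
      show "adj y z" if "y \<in> {p, x}" "z \<in> Q - {x}" for y z
        using x(2) padj(1) that by blast
      show "\<exists>!z. z \<in> {p, x} \<and> adj y z" if "y \<in> {p, x}" for y
        using that padj[OF x(1)] not_adj_self by blast
    qed
    moreover have "p \<noteq> x" using pQ x(1) by blast
    then have "card {p, x} = 2" "card (Q - {x}) = 3"
      using x(1) V(2) finQ by simp_all
    ultimately show ?thesis using matched_join_isomorphic by metis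
  next
    case no_star: False
    show ?thesis
    proof (cases "\<forall>x\<in>Q. \<forall>y\<in>Q. \<forall>z\<in>Q. adj x y \<longrightarrow> adj x z \<longrightarrow> y = z")
      case True
      have "matched_join Q {p}"
        unfolding matched_join_def
      proof (intro conjI ballI)
        show "V = Q \<union> {p}" using V(1) by blast
        show "Q \<inter> {p} = {}" using pQ by blast
        show "\<not> adj y z" if "y \<in> {p}" "z \<in> {p}" for y z using that by simp
        show "adj y z" if "y \<in> Q" "z \<in> {p}" for y z using that padj by blast
        show "\<exists>!z. z \<in> Q \<and> adj y z" if "y \<in> Q" for y
          using ex[OF that] True that by blast
      qed
      then show ?thesis using matched_join_isomorphic V(2)
        by (metis One_nat_def card.empty card.insert empty_iff finite.emptyI)
    next
      case False
      then obtain x y0 z0 where 0: "x \<in> Q" "y0 \<in> Q" "z0 \<in> Q" "adj x y0" "adj x z0" "y0 \<noteq> z0" by blast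
      have ne0: "x \<noteq> y0" "x \<noteq> z0" using 0 by auto
      have "card (Q - {x, y0, z0}) = 1"
        using 0 ne0 V(2) by (simp add: card_Diff_subset)
      then obtain v where v: "Q - {x, y0, z0} = {v}" unfolding card_1_singleton_iff One_nat_def by blast
      then have vQ: "v \<in> Q" "v \<noteq> x" "v \<noteq> y0" "v \<noteq> z0" by blast+
      have Q: "Q = {x, y0, z0, v}" using v 0 by blast
      have xv: "\<not> adj x v" using no_star 0 Q by blast
      have vx: "\<not> adj v x" using xv adj_sym by blast
      have "adj v y0 \<or> adj v z0" using ex[OF vQ(1)] Q vx by auto
      then obtain y z where yz: "Q = {x, y, z, v}" "adj x y" "adj x z" "adj v y" "y \<noteq> z"
        "v \<noteq> y" "v \<noteq> z" "x \<noteq> y" "x \<noteq> z"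
      proof
        assume "adj v y0"
        then show thesis using that[of y0 z0] Q 0 ne0 vQ by blast
      next
        assume "adj v z0"
        moreover have "Q = {x, z0, y0, v}" using Q by blast
        ultimately show thesis using that[of z0 y0] 0 ne0 vQ by blast
      qed
      have ins: "x \<in> Q" "y \<in> Q" "z \<in> Q" "v \<in> Q" using yz(1) by auto
      have rev: "adj y x" "adj z x" "adj y v" using yz adj_sym by blast+
      have nyz: "\<not> adj y z" "\<not> adj z y" using notri[of x y z] notri[of x z y] ins yz by blast+
      have ne: "p \<noteq> x" "p \<noteq> y" "p \<noteq> z" "p \<noteq> v" using ins pQ by blast+
      have Nx: "N x = {y, z, p}"
        using NQ[of x] yz(1-3) xv padj(2)[OF ins(1)] unfolding yz(1) by auto
      have Ny: "N y = {x, v, p}"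
        using NQ[of y] rev nyz padj(2)[OF ins(2)] unfolding yz(1) by auto
      have Np: "N p = {x, y, v, z}" using p(2) yz(1) by auto
      have less5: "(\<forall>i<5. P i) \<longleftrightarrow> P 0 \<and> P 1 \<and> P 2 \<and> P 3 \<and> P 4" for P :: "nat \<Rightarrow> bool"
      proof -
        have *: "{..<5} = {0, 1, 2, 3, 4 :: nat}" by auto
        have "(\<forall>i<5. P i) \<longleftrightarrow> (\<forall>i\<in>{..<5}. P i)"
          by (simp only: Ball_def lessThan_iff)
        then show ?thesis unfolding * by simp
      qed
      show ?thesis
      \<comment> \<open>The edges \<open>z x\<close>, \<open>x y\<close> and \<open>y v\<close> form
        a path in \<open>Q\<close>, and the pair \<open>v z\<close> decides whether it closes to a
        4-cycle.\<close>
      proof (cases "adj v z")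
        case True
        then have zv: "adj z v" using adj_sym by blast
        have Nv: "N v = {y, z, p}"
          using NQ[of v] True yz(4) vx padj(2)[OF ins(4)] unfolding yz(1) by auto
        have Nz: "N z = {x, v, p}"
          using NQ[of z] rev nyz zv padj(2)[OF ins(3)] unfolding yz(1) by auto
        let ?vs = "[x, y, v, z, p]"
        let ?rows = "[[1,3,4],[0,2,4],[1,3,4],[0,2,4],[0,1,2,3]] :: nat list list"
        have "isomorphic H H5b"
        proof (rule isomorphic_rowsI[of _ 5 ?vs])
          show "verts H5b = {1..5}" by (simp add: H5b_def)
          show "length ?vs = 5" by simp
          show "distinct ?vs" using yz ne vQ(2) by auto
          show "set ?vs = V" using V(1) yz(1) by auto
          show "list_all (\<lambda>i. list_all (\<lambda>j. adjacent H5b (Suc i) (Suc j) \<longleftrightarrow> List.member (?rows ! i) j)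
              [0..<5]) [0..<5]"
            by code_simp
          show "list_all (list_all (\<lambda>j. j < 5)) ?rows" "length ?rows = 5" by simp_all
          show "\<forall>i<5. N (?vs ! i) = (!) ?vs ` set (?rows ! i)"
            unfolding less5 using Nx Ny Nz Nv Np by (simp add: insert_commute)
        qed
        then show ?thesis by blast
      next
        case False
        then have zv: "\<not> adj z v" using adj_sym by blast
        have Nv: "N v = {y, p}"
          using NQ[of v] False yz(4) vx padj(2)[OF ins(4)] unfolding yz(1) by auto
        have Nz: "N z = {x, p}"
          using NQ[of z] rev nyz zv padj(2)[OF ins(3)] unfolding yz(1) by auto
        let ?vs = "[z, p, v, x, y]"
        let ?rows = "[[1,3],[0,2,3,4],[1,4],[0,1,4],[1,2,3]] :: nat list list"
        have "isomorphic H H5a"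
        proof (rule isomorphic_rowsI[of _ 5 ?vs])
          show "verts H5a = {1..5}" by (simp add: H5a_def)
          show "length ?vs = 5" by simp
          show "distinct ?vs" using yz ne vQ(2) by auto
          show "set ?vs = V" using V(1) yz(1) by auto
          show "list_all (\<lambda>i. list_all (\<lambda>j. adjacent H5a (Suc i) (Suc j) \<longleftrightarrow> List.member (?rows ! i) j)
              [0..<5]) [0..<5]"
            by code_simp
          show "list_all (list_all (\<lambda>j. j < 5)) ?rows" "length ?rows = 5" by simp_all
          show "\<forall>i<5. N (?vs ! i) = (!) ?vs ` set (?rows ! i)"
            unfolding less5 using Nx Ny Nz Nv Np by (simp add: insert_commute)
        qed
        then show ?thesis by blast
      qed
    qed
  qed
qed

end

section \<open>Orders 0, 2 and 3 modulo 4\<close>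

context extremal_cover
begin

text \<open>For even order the squares in \<open>sum_deviation\<close> are squares of odd numbers,
  so each is at least 1, while their total with the slacks is the order. Hence all slacks vanish and
  every degree is \<open>h\<close> or \<open>h + 1\<close>.\<close>

lemma even_order:
  assumes n: "card V = 2 * h" "h \<ge> 2"
  shows "isomorphic H (if even h then Kplus h h else Kplus (h + 1) (h - 1))"
proof -
  let ?h = "int h"
  have "(2 * ?h + 1)\<^sup>2 mod 8 = 1"
  proof -
    have "(2 * ?h + 1)\<^sup>2 = 4 * (?h * (?h + 1)) + 1" by (simp add: power2_eq_square algebra_simps)
    moreover have "even (?h * (?h + 1))" by simp
    then obtain k where "?h * (?h + 1) = 2 * k" by (rule evenE)
    ultimately have "(2 * ?h + 1)\<^sup>2 = 1 + 8 * k" by simp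
    then show ?thesis by simp
  qed
  then have sum: "(\<Sum>w\<in>V. (2 * d w - (2 * ?h + 1))\<^sup>2 + 4 * slack w) = int (card V) * 1"
    using sum_deviation n(1) by simp
  have odd_sq: "(2 * d w - (2 * ?h + 1))\<^sup>2 \<ge> 1" for w
  proof -
    have "2 * d w - (2 * ?h + 1) \<noteq> 0" by presburger
    then show ?thesis by (smt (verit) zero_less_power2)
  qed
  have eq1: "(2 * d w - (2 * ?h + 1))\<^sup>2 + 4 * slack w = 1" if "w \<in> V" for w
  proof (rule sum_eq_lower_bound[OF finite_verts _ _ that])
    show "1 \<le> (2 * d w - (2 * ?h + 1))\<^sup>2 + 4 * slack w" for w
      using odd_sq[of w] slack_nonneg[of w] by linarith
  qed (use sum in linarith)
  have s0: "slack w = 0" if "w \<in> V" for w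
    using eq1[OF that] odd_sq[of w] slack_nonneg[of w] by linarith
  have dh: "d w = ?h \<or> d w = ?h + 1" if "w \<in> V" for w
  proof -
    have "(2 * d w - (2 * ?h + 1))\<^sup>2 = 1" using eq1[OF that] s0[OF that] by simp
    then have "2 * d w - (2 * ?h + 1) = 1 \<or> 2 * d w - (2 * ?h + 1) = -1"
      by (simp add: power2_eq_1_iff)
    then show ?thesis by linarith
  qed
  from no_slack_cases[OF s0] show ?thesis
  proof
    assume "\<exists>U I. matched_join U I \<and> U \<noteq> {} \<and> I \<noteq> {}"
    then obtain U I where UI: "matched_join U I" "U \<noteq> {}" "I \<noteq> {}" by blast
    then obtain x where x: "x \<in> I" by blast
    then have "x \<in> V" using UI(1) by (auto simp: matched_join_def)
    \<comment> \<open>A vertex of \<open>I\<close> has degree \<open>card U\<close>, so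
      \<open>card U\<close> is \<open>h\<close> or \<open>h + 1\<close>. Its evenness decides which
      one.\<close>
    then have "card U = h \<or> card U = h + 1"
      using matched_join_props(3)[OF UI(1) x] dh[of x] by auto
    then have "(if even h then card U = h \<and> card I = h else card U = h + 1 \<and> card I = h - 1)"
      using matched_join_props(1,2)[OF UI(1)] n(1) by auto
    then show ?thesis
      using matched_join_isomorphic[OF UI(1)] by (auto split: if_splits)
  next
    assume "thin_cover H TT"
    then interpret thin_cover H TT .
    have dk: "d w = (if even h then ?h else ?h + 1)" if "w \<in> V" for w
      using dh[OF that] even_d[of w] by auto
    have "V \<noteq> {}" using n by auto
    then obtain w where w: "w \<in> V" by blast
    have "d w > 0" using dh[OF w] n(2) by auto
    then obtain a b where ab: "adj w a" "adj a b" "adj w b"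
      using d_pos_triangle[OF s0[OF w]] by blast
    then have "d w + d a + d b = 2 * ?h + 3" using triangle_d_sum[OF ab] n(1) by simp
    moreover have "d a = d w" "d b = d w" using dk w adj_verts[OF ab(2)] by auto
    \<comment> \<open>Degree \<open>h\<close> would force \<open>h = 3\<close>, although that degree
      belongs to even \<open>h\<close>. Degree \<open>h + 1\<close> would force
      \<open>h = 0\<close>.\<close>
    ultimately have "3 * d w = 2 * ?h + 3" by linarith
    then have False using dk[OF w] n(2) by (auto split: if_splits)
    then show ?thesis ..
  qed
qed

text \<open>Here the right-hand side of \<open>sum_deviation\<close> is 0, so there is no slack and
  every degree equals \<open>k\<close>.\<close>

lemma order_3_mod_4:
  assumes n: "card V + 1 = 2 * k" "even k" "k \<ge> 2"
  shows "isomorphic H (Kplus k (k - 1))"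
proof -
  let ?k = "int k"
  have nk: "int (card V) + 1 = 2 * ?k" using n(1) by linarith
  obtain m where "k = 2 * m" using n(2) by (rule evenE)
  then have "(2 * ?k)\<^sup>2 mod 8 = 0" by (simp add: power2_eq_square)
  then have sum: "(\<Sum>w\<in>V. (2 * d w - 2 * ?k)\<^sup>2 + 4 * slack w) = int (card V) * 0"
    using sum_deviation nk by simp
  have eq0: "(2 * d w - 2 * ?k)\<^sup>2 + 4 * slack w = 0" if "w \<in> V" for w
  proof (rule sum_eq_lower_bound[OF finite_verts _ _ that])
    show "0 \<le> (2 * d w - 2 * ?k)\<^sup>2 + 4 * slack w" for w
      using slack_nonneg[of w] by simp
  qed (use sum in linarith)
  have s0: "slack w = 0" if "w \<in> V" for w
    using eq0[OF that] slack_nonneg[of w] zero_le_power2[of "2 * d w - 2 * ?k"] by linarith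
  have dk: "d w = ?k" if "w \<in> V" for w
    using eq0[OF that] s0[OF that] by simp
  from no_slack_cases[OF s0] show ?thesis
  proof
    assume "\<exists>U I. matched_join U I \<and> U \<noteq> {} \<and> I \<noteq> {}"
    then obtain U I where UI: "matched_join U I" "U \<noteq> {}" "I \<noteq> {}" by blast
    then obtain x where x: "x \<in> I" by blast
    then have "x \<in> V" using UI(1) by (auto simp: matched_join_def)
    then have "card U = k" using matched_join_props(3)[OF UI(1) x] dk[of x] by auto
    moreover from this have "card I = k - 1" using matched_join_props(2)[OF UI(1)] n(1) by auto
    ultimately show ?thesis using matched_join_isomorphic[OF UI(1)] by simp
  next
    assume "thin_cover H TT"
    then interpret thin_cover H TT .
    have "V \<noteq> {}" using n by auto
    then obtain w where w: "w \<in> V" by blast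
    have "d w > 0" using dk[OF w] n(3) by auto
    then obtain a b where ab: "adj w a" "adj a b" "adj w b"
      using d_pos_triangle[OF s0[OF w]] by blast
    have V: "a \<in> V" "b \<in> V" using ab adj_verts by blast+
    have "d w + d a + d b = int (card V) + 3" using triangle_d_sum[OF ab] .
    \<comment> \<open>Three degrees \<open>k\<close> add up to
      \<open>card V + 3 = 2 * k + 2\<close>, so the only thin case is a single triangle, which is
      \<open>Kplus 2 1\<close>.\<close>
    then have k: "k = 2" "card V = 3" using dk w V nk by auto
    have ne: "w \<noteq> a" "a \<noteq> b" "w \<noteq> b" using ab by auto
    have "{w, a, b} = V"
      using w V ne k(2) finite_verts by (intro card_subset_eq) auto
    have rev: "adj a w" using ab adj_sym by blast
    have "matched_join {w, a} {b}"
      unfolding matched_join_def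
    proof (intro conjI ballI)
      show "V = {w, a} \<union> {b}" using \<open>{w, a, b} = V\<close> by blast
      show "{w, a} \<inter> {b} = {}" using ne by blast
      show "\<not> adj y z" if "y \<in> {b}" "z \<in> {b}" for y z using that by simp
      show "adj y z" if "y \<in> {w, a}" "z \<in> {b}" for y z using that ab by blast
      show "\<exists>!z. z \<in> {w, a} \<and> adj y z" if "y \<in> {w, a}" for y
        using that ab(1) rev not_adj_self by blast
    qed
    from matched_join_isomorphic[OF this] show ?thesis using ne k by (simp add: numeral_2_eq_2)
  qed
qed

end

section \<open>Vertices of large degree\<close>

definition exceptional_or_Kplus :: "'a ugraph \<Rightarrow> bool" where
  "exceptional_or_Kplus G \<longleftrightarrow> isomorphic G H5a \<or> isomorphic G H5b \<or> isomorphic G H9 \<or>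
     (\<exists>s. 1 < s \<and> s < card (verts G) \<and>
        2 * s \<in> {card (verts G) - 1, card (verts G) + 1, card (verts G) + 3} \<and>
        isomorphic G (Kplus s (card (verts G) - s)))"

section \<open>Order 2k - 1 with k odd, that is, order 1 modulo 4\<close>

locale critical_cover = extremal_cover +
  fixes k :: nat
  assumes card_verts: "card (verts H) + 1 = 2 * k" and odd_k: "odd k" and k_ge: "k \<ge> 3"
begin

definition g :: "'a \<Rightarrow> int" where "g v = d v - int k"

lemma card_V: "int (card V) = 2 * int k - 1"
  using card_verts by linarith

text \<open>This is \<open>sum_deviation\<close> divided by 4. The mean of
  \<open>(g w)\<^sup>2 + slack w\<close> is exactly 1, so slack is possible here, but only at
  vertices that other terms compensate.\<close>

lemma sum_g_sq: "(\<Sum>w\<in>V. (g w)\<^sup>2 + slack w) = 2 * int k - 1"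
proof -
  obtain m where "k = 2 * m + 1" using odd_k by (rule oddE)
  then have "(2 * int k)\<^sup>2 = 8 * (2 * int m * (int m + 1)) + 4"
    by (simp add: power2_eq_square algebra_simps)
  moreover have "(8 * x + 4) mod 8 = 4" for x :: int by presburger
  ultimately have "(2 * int k)\<^sup>2 mod 8 = 4" by metis
  moreover have "(\<Sum>w\<in>V. (2 * d w - (int (card V) + 1))\<^sup>2 + 4 * slack w) = 4 * (\<Sum>w\<in>V. (g w)\<^sup>2 + slack w)"
    unfolding sum_distrib_left card_V g_def by (intro sum.cong) (simp_all add: power2_eq_square algebra_simps)
  ultimately show ?thesis
    using sum_deviation card_V by simp
qed

lemma twice_TT: "2 * int (card TT) = int k * (int k - 1) + 1 + (\<Sum>x\<in>V. g x)"
proof -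
  obtain m where m: "k = 2 * m + 1" using odd_k by (rule oddE)
  have "(2 * int k)\<^sup>2 = 8 * (2 * int m * (int m + 1)) + 4"
    unfolding m by (simp add: power2_eq_square algebra_simps)
  then have "(2 * int k)\<^sup>2 div 8 = 2 * int m * (int m + 1)" by simp
  then have E: "int (card (edges H)) - int (card TT) = 2 * int m * (int m + 1)"
    using edge_count card_V by simp
  have "(\<Sum>x\<in>V. g x) = 2 * int (card (edges H)) - int (card V) * int k"
    unfolding g_def sum_subtractf handshake by simp
  then show ?thesis
    using E unfolding card_V m by (simp add: algebra_simps)
qed

text \<open>Both \<open>2 * card TT\<close> and the number of walks from \<open>p\<close> are linear
  in the values of \<open>g\<close>, and the neighbours of \<open>p\<close> cancel. The set
  \<open>V - N p\<close> contains \<open>p\<close> itself.\<close>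

lemma slack_eq_nonneighbours:
  assumes "p \<in> V"
  shows "slack p = 1 + (\<Sum>x\<in>V - N p. g x) - g p * (int k - 1)"
proof -
  have "(\<Sum>x\<in>V. g x) = (\<Sum>x\<in>V - N p. g x) + (\<Sum>x\<in>N p. g x)"
    using sum.subset_diff[OF N_subset finite_verts] .
  moreover have "(\<Sum>x\<in>N p. d x - 1) = (\<Sum>x\<in>N p. g x + (int k - 1))"
    by (simp add: g_def)
  then have "(\<Sum>x\<in>N p. d x - 1) = (\<Sum>x\<in>N p. g x) + d p * (int k - 1)"
    unfolding sum.distrib d_def by simp
  moreover have "d p = int k + g p" by (simp add: g_def)
  ultimately show ?thesis
    unfolding slack_def twice_TT by (simp add: algebra_simps)
qed

lemma KplusI:
  assumes "isomorphic H (Kplus s t)" "s + t = card V" "s \<in> {k - 1, k, k + 1}"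
  shows "exceptional_or_Kplus H"
proof -
  have "1 < s" "s < card V" using assms(3) k_ge card_verts by auto
  moreover have "2 * s \<in> {card V - 1, card V + 1, card V + 3}"
    using assms(3) card_verts k_ge by auto
  moreover have "t = card V - s" using assms(2) by simp
  ultimately show ?thesis
    unfolding exceptional_or_Kplus_def using assms(1) by blast
qed

text \<open>The squares alone exhaust \<open>sum_g_sq\<close>, so no vertex has slack and the
  dichotomy applies.\<close>

lemma regular:
  assumes g: "\<And>v. v \<in> V \<Longrightarrow> g v = c" and c: "c \<in> {1, -1}"
  shows "exceptional_or_Kplus H"
proof -
  have sq: "(g w)\<^sup>2 = 1" if "w \<in> V" for w using g[OF that] c by auto
  have "(\<Sum>w\<in>V. slack w) \<le> int (card V) * 0"
    using sum_g_sq sq card_V by (simp add: sum.distrib)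
  then have s0: "slack w = 0" if "w \<in> V" for w
    using sum_eq_lower_bound[OF finite_verts slack_nonneg _ that] by simp
  have dk: "d w = int k + c" if "w \<in> V" for w using g[OF that] by (simp add: g_def)
  from no_slack_cases[OF s0] show ?thesis
  proof
    assume "\<exists>U I. matched_join U I \<and> U \<noteq> {} \<and> I \<noteq> {}"
    then obtain U I x y where UI: "matched_join U I" "x \<in> I" "y \<in> U" by blast
    then have "x \<in> U \<union> I" "y \<in> U \<union> I" "V = U \<union> I" unfolding matched_join_def by blast+
    then have "x \<in> V" "y \<in> V" by simp_all
    then have "int (card U) = int k + c" "int (card I) + 1 = int k + c"
      using matched_join_props(3)[OF UI(1,2)] matched_join_props(4)[OF UI(1,3)] dk by simp_all
    \<comment> \<open>The two degree conditions give
      \<open>card U + card I = 2 * k + 2 * c - 1\<close>, which is not the order because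
      \<open>c\<close> is nonzero.\<close>
    then have False using matched_join_props(2)[OF UI(1)] card_V c by auto
    then show ?thesis ..
  next
    assume "thin_cover H TT"
    then interpret thin_cover H TT .
    have "V \<noteq> {}" using card_V k_ge by auto
    then obtain w where w: "w \<in> V" by blast
    have "d w > 0" using dk[OF w] c k_ge by auto
    then obtain a b where ab: "adj w a" "adj a b" "adj w b"
      using d_pos_triangle[OF s0[OF w]] by blast
    then have V: "a \<in> V" "b \<in> V" using adj_verts by blast+
    have "d w + d a + d b = int (card V) + 3" using triangle_d_sum[OF ab] .
    then have "3 * (int k + c) = 2 * int k + 2" using dk w V card_V by simp
    \<comment> \<open>The equation reads \<open>k = 2 - 3 * c\<close>; the value
      \<open>c = 1\<close> would make \<open>k\<close> negative.\<close>
    then have "k = 5" "c = -1" using c k_ge by auto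
    then have "isomorphic H H9"
      using card_V dk by (intro isomorphic_H9) auto
    then show ?thesis by (simp add: exceptional_or_Kplus_def)
  qed
qed

lemma card_nonneighbours:
  assumes "p \<in> V"
  shows "int (card (V - N p - {p})) = int k - 2 - g p" "int (card (V - N p)) = int k - 1 - g p"
proof -
  have p: "p \<in> V - N p" using assms by auto
  have "card (V - N p) = card V - card (N p)"
    using card_Diff_subset[OF finite_N N_subset] .
  moreover have "card (N p) \<le> card V" using card_mono[OF finite_verts N_subset] .
  ultimately show *: "int (card (V - N p)) = int k - 1 - g p"
    using card_V by (simp add: g_def d_def)
  have "card (V - N p) = Suc (card (V - N p - {p}))"
    using card_Suc_Diff1[of "V - N p" p] p finite_verts by simp
  then show "int (card (V - N p - {p})) = int k - 2 - g p" using * by simp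
qed

lemma sum_nonneighbours:
  assumes "p \<in> V"
  shows "(\<Sum>x\<in>V - N p. g x) = g p + (\<Sum>x\<in>V - N p - {p}. g x)"
  using assms finite_verts by (intro sum.remove) auto

text \<open>A large \<open>g p\<close> forces, through nonnegativity of the slack, a large sum of
  \<open>g\<close> over the few nonneighbours of \<open>p\<close>. Their squares would then exceed
  the total allowed by \<open>sum_g_sq\<close>.\<close>

lemma g_le_1:
  assumes p: "p \<in> V"
  shows "g p \<le> 1"
proof (rule ccontr)
  assume "\<not> g p \<le> 1"
  then have g2: "g p \<ge> 2" by simp
  let ?W = "V - N p - {p}"
  define c s q where "c = int (card ?W)" and "s = (\<Sum>x\<in>?W. g x)" and "q = (\<Sum>x\<in>?W. (g x)\<^sup>2)"
  have c: "c = int k - 2 - g p" unfolding c_def by (rule card_nonneighbours[OF p])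
  have s: "s \<ge> g p * (int k - 2) - 1"
    using slack_eq_nonneighbours[OF p] slack_nonneg[of p] sum_nonneighbours[OF p]
    by (simp add: s_def algebra_simps)
  \<comment> \<open>Centring the squares at \<open>g p\<close> rather than at the mean bounds
    \<open>q\<close> from below by an expression linear in \<open>s\<close>, without division by
    \<open>c\<close>.\<close>
  have "0 \<le> (\<Sum>x\<in>?W. (g x - g p)\<^sup>2)" by (simp add: sum_nonneg)
  also have "\<dots> = q - 2 * g p * s + (g p)\<^sup>2 * c"
    unfolding q_def s_def c_def
    by (simp add: power2_diff sum.distrib sum_subtractf sum_distrib_left algebra_simps)
  finally have q: "q \<ge> 2 * g p * s - (g p)\<^sup>2 * c" by simp
  have "(g p)\<^sup>2 + q \<le> (\<Sum>w\<in>V. (g w)\<^sup>2 + slack w)"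
  proof -
    have "(g p)\<^sup>2 + q = (\<Sum>w\<in>insert p ?W. (g w)\<^sup>2)"
      unfolding q_def using finite_verts by (subst sum.insert) auto
    also have "\<dots> \<le> (\<Sum>w\<in>V. (g w)\<^sup>2)"
      using p finite_verts by (intro sum_mono2) auto
    also have "\<dots> \<le> (\<Sum>w\<in>V. (g w)\<^sup>2 + slack w)"
      using slack_nonneg by (intro sum_mono) auto
    finally show ?thesis .
  qed
  then have tot: "(g p)\<^sup>2 + q \<le> 2 * int k - 1" using sum_g_sq by simp
  have "g p * s \<ge> g p * (g p * (int k - 2) - 1)"
    using s g2 by (intro mult_left_mono) auto
  then have "q \<ge> 2 * (g p * (g p * (int k - 2) - 1)) - (g p)\<^sup>2 * (int k - 2 - g p)"
    using q unfolding c by linarith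
  also have "2 * (g p * (g p * (int k - 2) - 1)) - (g p)\<^sup>2 * (int k - 2 - g p) =
      (g p)\<^sup>2 * (int k - 2) + g p * ((g p)\<^sup>2 - 2)"
    by (simp add: power2_eq_square algebra_simps)
  finally have q2: "q \<ge> (g p)\<^sup>2 * (int k - 2) + g p * ((g p)\<^sup>2 - 2)" .
  \<comment> \<open>With \<open>g p\<close> at least 2 the bounds add up to 4 + 4 (k - 2) + 4 = 4k,
    beyond the total 2k - 1.\<close>
  have sq4: "(g p)\<^sup>2 \<ge> 4" using power_mono[of 2 "g p" 2] g2 by simp
  then have "(g p)\<^sup>2 * (int k - 2) \<ge> 4 * (int k - 2)"
    using k_ge by (intro mult_right_mono) auto
  moreover have "g p * ((g p)\<^sup>2 - 2) \<ge> 2 * 2"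
    using g2 sq4 by (intro mult_mono) auto
  moreover have False
    if "4 * (int k - 2) \<le> a" "2 * 2 \<le> b" "a + b \<le> q" "c + q \<le> 2 * int k - 1" "4 \<le> c" for a b c q
    using that k_ge by presburger
  ultimately show False using q2 tot sq4 by blast
qed

text \<open>There are k - 3 nonneighbours other than \<open>p\<close>, and nonnegative slack forces
  their values of \<open>g\<close> to add up to at least k - 3. None exceeds 1, so all equal 1 and
  the slack is zero.\<close>

lemma g_1:
  assumes p: "p \<in> V" "g p = 1"
  shows "slack p = 0" "x \<in> V \<Longrightarrow> \<not> adj p x \<Longrightarrow> g x = 1"
proof -
  let ?W = "V - N p - {p}"
  have c: "int (card ?W) = int k - 3" using card_nonneighbours[OF p(1)] p(2) by simp
  have s: "slack p = 1 + (1 + (\<Sum>x\<in>?W. g x)) - (int k - 1)"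
    using slack_eq_nonneighbours[OF p(1)] sum_nonneighbours[OF p(1)] p(2) by simp
  have all1: "g x = 1" if "x \<in> ?W" for x
  proof -
    have "- g x = -1"
    proof (rule sum_eq_lower_bound[OF _ _ _ that])
      show "-1 \<le> - g y" if "y \<in> ?W" for y using g_le_1[of y] that by auto
      show "(\<Sum>x\<in>?W. - g x) \<le> int (card ?W) * -1"
        using s slack_nonneg[of p] c by (simp add: sum_negf)
    qed (use finite_verts in auto)
    then show ?thesis by simp
  qed
  then have "(\<Sum>x\<in>?W. g x) = int (card ?W)" by simp
  then show "slack p = 0" using s c by simp
  show "g x = 1" if "x \<in> V" "\<not> adj p x"
    using all1[of x] that p(2) by (cases "x = p") auto
qed

text \<open>The vertices with \<open>g = 1\<close> form \<open>R\<close>; they have no slack, and by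
  \<open>g_1\<close> they see everything outside \<open>R\<close>. An edge inside \<open>R\<close>
  makes \<open>R\<close> the matched part and \<open>Q\<close> independent. If \<open>R\<close> is
  independent with at least two vertices, the roles are exchanged. A single vertex in
  \<open>R\<close> leaves a wheel-like graph on five vertices.\<close>

lemma high_degree:
  assumes "p \<in> V" "g p \<ge> 1"
  shows "exceptional_or_Kplus H"
proof -
  define R where "R = {v \<in> V. g v = 1}"
  define Q where "Q = V - R"
  have R: "slack r = 0" "r \<in> V" "d r = int k + 1" if "r \<in> R" for r
  proof -
    have r: "r \<in> V" "g r = 1" using that by (simp_all add: R_def)
    then show "slack r = 0" "r \<in> V" "d r = int k + 1"
      using g_1(1)[OF r] by (simp_all add: g_def)
  qed
  have "p \<in> R" using assms g_le_1[of p] by (simp add: R_def)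
  have RV: "R \<subseteq> V" by (auto simp: R_def)
  have V: "V = Q \<union> R" "Q \<inter> R = {}" using RV by (auto simp: Q_def)
  have fin: "finite R" "finite Q" using V finite_verts by auto
  have cardV: "card Q + card R = card V" using V fin card_Un_disjoint by metis
  have RQ: "adj r q" if "r \<in> R" "q \<in> Q" for r q
  proof (rule ccontr)
    assume "\<not> adj r q"
    then have "g q = 1" using g_1(2)[of r q] that by (auto simp: R_def Q_def)
    then show False using that by (auto simp: R_def Q_def)
  qed
  have QR: "adj q r" if "r \<in> R" "q \<in> Q" for r q using RQ[OF that] adj_sym by blast
  have inner: "int (card (N r \<inter> R)) + int (card Q) = int k + 1" if "r \<in> R" for r
  proof -
    have "N r \<inter> (V - R) = Q" using RQ[OF that] by (auto simp: Q_def)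
    then show ?thesis using card_N_inter_split[OF RV, of r] R(3)[OF that] by (simp add: d_def)
  qed
  show ?thesis
  proof (cases "Q = {}")
    case True
    then have "g v = 1" if "v \<in> V" for v using that by (auto simp: Q_def R_def)
    then show ?thesis using regular[of 1] by simp
  next
    case False
    then obtain q0 where q0: "q0 \<in> Q" by blast
    show ?thesis
    proof (cases "\<exists>r\<in>R. \<exists>r'\<in>R. adj r r'")
      case True
      then obtain r r' where r: "r \<in> R" "r' \<in> R" "adj r r'" by blast
      \<comment> \<open>The vertex \<open>r\<close> sees all three vertices of the triangle formed
        by \<open>r'\<close> and an edge inside \<open>Q\<close>, which a vertex without slack
        cannot do.\<close>
      have Qindep: "\<not> adj x y" if "x \<in> Q" "y \<in> Q" for x y
      proof
        assume "adj x y"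
        moreover have "r \<noteq> r'" "r \<noteq> x" "r \<noteq> y" using r that V(2) by auto
        ultimately show False
          using slack_0_no_triangle[OF R(1)[OF r(1)], of r' x y] RQ r that by blast
      qed
      have "int (card (N y \<inter> R)) = int (card (N r \<inter> R))" if "y \<in> R" for y
        using inner[OF that] inner[OF r(1)] by linarith
      then have same: "card (N y \<inter> R) = card (N r \<inter> R)" if "y \<in> R" for y using that by simp
      have "card (N r \<inter> R) > 0" using r fin by (auto simp: card_gt_0_iff)
      then have ex: "\<exists>z\<in>R. adj y z" if "y \<in> R" for y
      proof -
        have "N y \<inter> R \<noteq> {}" using same[OF that] \<open>card (N r \<inter> R) > 0\<close> by auto
        then show ?thesis by auto
      qed
      \<comment> \<open>If \<open>y\<close> misses another vertex \<open>x\<close> of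
        \<open>R\<close>, then \<open>x\<close> sees \<open>q0\<close> but not \<open>y\<close>, so
        the edge \<open>q0 y\<close> has only one common neighbour. Otherwise \<open>y\<close> sees
        the rest of \<open>R\<close>, and equal degrees inside \<open>R\<close> make
        \<open>R\<close> a clique; then \<open>y\<close> would see a whole triangle
        \<open>y' y'' q0\<close>.\<close>
      have uniq: "y' = y''" if y: "y \<in> R" "y' \<in> R" "y'' \<in> R" "adj y y'" "adj y y''" for y y' y''
      proof (rule ccontr)
        assume ne: "y' \<noteq> y''"
        show False
        proof (cases "\<exists>x\<in>R. x \<noteq> y \<and> \<not> adj x y")
          case True
          then obtain x where x: "x \<in> R" "x \<noteq> y" "\<not> adj x y" by blast
          have "q0 \<noteq> x" using x q0 V by blast
          then show False
            using slack_0_unique_common[OF R(1)[OF x(1)], of q0 y y' y''] x y q0 ne RQ QR by blast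
        next
          case False
          then have "R - {y} \<subseteq> N y \<inter> R" using adj_sym[of y] by auto
          then have 1: "card (R - {y'}) \<le> card (N y' \<inter> R)"
            using same[OF y(1)] same[OF y(2)] card_mono[of "N y \<inter> R" "R - {y}"] fin y(1,2) by simp
          have 2: "N y' \<inter> R \<subseteq> R - {y'}" by auto
          have "N y' \<inter> R = R - {y'}"
            by (rule card_seteq[OF _ 2 1]) (simp add: fin)
          then have "y'' \<in> N y' \<inter> R" using ne y(3) by simp
          then have "adj y' y''" by simp
          moreover have "y \<noteq> y'" "y \<noteq> y''" "y \<noteq> q0" using y q0 V(2) by auto
          ultimately show False
            using slack_0_no_triangle[OF R(1)[OF y(1)], of y' y'' q0] y q0 RQ by blast
        qed
      qed
      have mj: "matched_join R Q"
        unfolding matched_join_def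
      proof (intro conjI ballI)
        show "V = R \<union> Q" by (subst Un_commute) (rule V)
        show "R \<inter> Q = {}" by (subst Int_commute) (rule V)
        show "\<exists>!z. z \<in> R \<and> adj y z" if "y \<in> R" for y
          using ex[OF that] uniq[OF that] by blast
      qed (fact Qindep RQ)+
      have "card Q = k"
        using matched_join_props(4)[OF mj r(1)] R(3)[OF r(1)] by simp
      moreover from this have "card R = k - 1" using cardV card_verts by simp
      ultimately show ?thesis
        using KplusI[OF matched_join_isomorphic[OF mj]] cardV by simp
    next
      case False
      then have indep: "\<not> adj x y" if "x \<in> R" "y \<in> R" for x y using that by blast
      then have "N p \<inter> R = {}" using \<open>p \<in> R\<close> by auto
      then have cardQ: "card Q = k + 1" using inner[OF \<open>p \<in> R\<close>] by simp
      show ?thesis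
      proof (cases "\<exists>r\<in>R. r \<noteq> p")
        case True
        then obtain r where r: "r \<in> R" "r \<noteq> p" by blast
        have mj: "matched_join Q R"
          unfolding matched_join_def
        proof (intro conjI ballI)
          show "V = Q \<union> R" "Q \<inter> R = {}" by (fact V)+
          show "\<exists>!z. z \<in> Q \<and> adj y z" if y: "y \<in> Q" for y
          proof -
            obtain z where z: "adj p z" "adj y z"
              using slack_0_not_isolated[OF R(1)[OF \<open>p \<in> R\<close>] RQ[OF \<open>p \<in> R\<close> y]] by blast
            have "z \<in> Q" using z(1) indep[OF \<open>p \<in> R\<close>] adj_verts[OF z(1)] V(1) by auto
            \<comment> \<open>The second vertex \<open>r\<close> of \<open>R\<close> is used here:
              \<open>p\<close> sees \<open>y\<close> but not \<open>r\<close>, so the edge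
              \<open>y r\<close> has one common neighbour, while both \<open>z\<close> and
              \<open>z'\<close> are such.\<close>
            moreover have "z' = z" if "z' \<in> Q" "adj y z'" for z'
            proof -
              have "y \<noteq> p" using y \<open>p \<in> R\<close> V(2) by blast
              then show ?thesis
                using slack_0_unique_common[OF R(1)[OF \<open>p \<in> R\<close>], of y r z' z] r y \<open>p \<in> R\<close> indep RQ QR
                  that z \<open>z \<in> Q\<close> by blast
            qed
            ultimately show ?thesis using z(2) by blast
          qed
        qed (use indep QR in blast)+
        show ?thesis
          using KplusI[OF matched_join_isomorphic[OF mj]] cardV cardQ by simp
      next
        case False
        then have Rp: "R = {p}" using \<open>p \<in> R\<close> by blast
        \<comment> \<open>With \<open>card R = 1\<close> and \<open>card Q = k + 1\<close> the order
          2k - 1 equals k + 2.\<close>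
        then have k: "k = 3" using cardV cardQ card_verts by simp
        have "N p = Q" using RQ[OF \<open>p \<in> R\<close>] \<open>N p \<inter> R = {}\<close> N_subset[of p] V(1) by auto
        moreover have "V = insert p Q" "card Q = 4" using V(1) Rp cardQ k by auto
        ultimately have "isomorphic H H5a \<or> isomorphic H H5b \<or> isomorphic H (Kplus 2 3) \<or> isomorphic H (Kplus 4 1)"
          using wheel_cases[OF R(1)[OF \<open>p \<in> R\<close>]] by blast
        moreover have "exceptional_or_Kplus H" if "isomorphic H (Kplus 2 3)"
          using KplusI[OF that] k card_verts by simp
        moreover have "exceptional_or_Kplus H" if "isomorphic H (Kplus 4 1)"
          using KplusI[OF that] k card_verts by simp
        ultimately show ?thesis
          by (auto simp: exceptional_or_Kplus_def[of H])
      qed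
    qed
  qed
qed

end

section \<open>No vertices of large degree\<close>

context triple_cover
begin

text \<open>Every neighbour of \<open>w\<close> has a partner among the neighbours. An odd set has
  no perfect matching, so some neighbour has two partners.\<close>

lemma thick_edge_at_odd_vertex:
  assumes "slack w = 0" "odd (card (N w))"
  obtains x y z where "adj w x" "adj w y" "adj w z" "adj x y" "adj x z" "y \<noteq> z"
proof -
  have "\<not> (\<forall>x\<in>N w. \<exists>!y. y \<in> N w \<and> adj x y)"
  proof
    assume *: "\<forall>x\<in>N w. \<exists>!y. y \<in> N w \<and> adj x y"
    have "even (card (N w))"
    proof (rule even_card_matching[of "N w" adj])
      show "adj x y \<Longrightarrow> adj y x" for x y using adj_sym by blast
      show "\<exists>!y. y \<in> N w \<and> adj x y" if "x \<in> N w" for x using * that by blast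
    qed simp_all
    then show False using assms(2) by simp
  qed
  then obtain x where "x \<in> N w" and x2: "\<not> (\<exists>!y. y \<in> N w \<and> adj x y)" by blast
  then have x: "adj w x" by simp
  moreover obtain y where "adj w y" "adj x y" using slack_0_not_isolated[OF assms(1) x] by blast
  ultimately show thesis using that[of x] x2 by auto
qed

text \<open>Every \<open>w\<close> in \<open>Z\<close> lies on a thick edge, one with two common
  neighbours, and \<open>x\<close> is its other end. The vertices of \<open>Z\<close> off this edge
  cannot distinguish its ends and see each common neighbour exactly when they miss the ends. As
  common neighbours themselves lie outside \<open>Z\<close>, \<open>w\<close> has no neighbour in
  \<open>Z\<close> except possibly \<open>x\<close>.\<close>

lemma odd_no_slack_vertices:
  assumes Z: "\<And>w. w \<in> Z \<Longrightarrow> slack w = 0 \<and> odd (card (N w))" and "card Z \<ge> 4" and w: "w \<in> Z"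
  obtains x where "adj w x" "N w \<inter> Z \<subseteq> {x}"
    and "\<And>v z. v \<in> Z \<Longrightarrow> v \<noteq> w \<Longrightarrow> v \<noteq> x \<Longrightarrow> adj w z \<Longrightarrow> adj x z \<Longrightarrow> adj v z"
    and "\<And>z y. adj w z \<Longrightarrow> adj x z \<Longrightarrow> adj w y \<Longrightarrow> adj z y \<Longrightarrow> y = x"
proof -
  \<comment> \<open>With at least four members, \<open>Z\<close> has one outside any given triangle,
    so \<open>slack_0_no_fat_triangle\<close> applies to every triangle of the graph.\<close>
  have nofat: False
    if "adj a b" "adj b c" "adj a c" "adj a p" "adj b p" "p \<noteq> c" "adj a q" "adj c q" "q \<noteq> b" for a b c p q
  proof -
    have "card {a, b, c} \<le> 3" by (simp add: card_insert_if)
    then have "\<not> Z \<subseteq> {a, b, c}" using card_mono[of "{a, b, c}" Z] assms(2) by auto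
    then obtain v where v: "v \<in> Z" "v \<noteq> a" "v \<noteq> b" "v \<noteq> c" by blast
    then have "slack v = 0" using Z by blast
    from slack_0_no_fat_triangle[OF this v(2-4) that] show False .
  qed
  define thick where "thick u x \<longleftrightarrow> adj u x \<and> (\<exists>y z. adj u y \<and> adj u z \<and> adj x y \<and> adj x z \<and> y \<noteq> z)" for u x
  have thick_ex: "\<exists>x. thick u x" if "u \<in> Z" for u
  proof -
    have "slack u = 0" "odd (card (N u))" using Z[OF that] by blast+
    then obtain x y z where "adj u x" "adj u y" "adj u z" "adj x y" "adj x z" "y \<noteq> z"
      by (rule thick_edge_at_odd_vertex)
    then show ?thesis unfolding thick_def by blast
  qed
  have thick_sym: "thick x u" if "thick u x" for u x
    using that adj_sym[of u x] unfolding thick_def by blast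
  \<comment> \<open>A thick edge already has a second common neighbour \<open>p\<close>. A second
    common neighbour on another side of the triangle \<open>u x z\<close> would make it fat.\<close>
  have apex: "y = x" if t: "thick u x" and z: "adj u z" "adj x z" "adj u y" "adj z y" for u x y z
  proof (rule ccontr)
    assume "y \<noteq> x"
    have "\<exists>p. adj u p \<and> adj x p \<and> p \<noteq> z" using t unfolding thick_def by blast
    then obtain p where "adj u p" "adj x p" "p \<noteq> z" by blast
    moreover have "adj u x" using t unfolding thick_def by blast
    ultimately show False using nofat[of u x z p y] z \<open>y \<noteq> x\<close> by blast
  qed
  have far: "adj v u = adj v x" "v \<noteq> z \<Longrightarrow> adj u z \<Longrightarrow> adj x z \<Longrightarrow> adj v z = (\<not> adj v u)"
    if t: "thick u x" and v: "v \<in> Z" "v \<noteq> u" "v \<noteq> x" for u x v z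
  proof -
    have s: "slack v = 0" using Z[OF v(1)] by blast
    have ux: "adj u x" "u \<noteq> v" "x \<noteq> v" using t v unfolding thick_def by blast+
    obtain a b where ab: "adj u a" "adj u b" "adj x a" "adj x b" "a \<noteq> b"
      using t unfolding thick_def by blast
    show same: "adj v u = adj v x"
      using slack_0_unique_common[OF s, of u x a b] ux ab by blast
    show "adj v z = (\<not> adj v u)" if "v \<noteq> z" "adj u z" "adj x z"
      using slack_0_no_triangle[OF s ux(1) that(3,2)] same v that(1) by blast
  qed
  obtain x where x: "thick w x" using thick_ex[OF w] by blast
  have wx: "adj w x" using x unfolding thick_def by blast
  \<comment> \<open>If \<open>z\<close> were in \<open>Z\<close>, it would have a thick edge
    \<open>z x'\<close> of its own, with \<open>x'\<close> different from \<open>w\<close> and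
    \<open>x\<close> by \<open>apex\<close>. Since \<open>w\<close> cannot distinguish the ends of
    that edge, it sees \<open>x'\<close>, and \<open>apex\<close> then forces
    \<open>x' = x\<close>.\<close>
  have apexZ: "z \<notin> Z" if z: "adj w z" "adj x z" for z
  proof
    assume "z \<in> Z"
    then obtain x' where x': "thick z x'" using thick_ex by blast
    obtain a b where ab: "adj z x'" "adj z a" "adj z b" "adj x' a" "adj x' b" "a \<noteq> b"
      using x' unfolding thick_def by blast
    have zw: "adj z w" "adj z x" "adj x w" using z wx adj_sym by blast+
    have "x' \<noteq> w" using apex[OF x z, of a] apex[OF x z, of b] ab by blast
    moreover have "x' \<noteq> x"
      using apex[OF thick_sym[OF x] z(2) z(1), of a] apex[OF thick_sym[OF x] z(2) z(1), of b] ab by blast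
    moreover have "w \<noteq> z" using z by auto
    ultimately have "adj w x'" using far(1)[OF x' w] z(1) by blast
    then show False using apex[OF x z _ ab(1)] \<open>x' \<noteq> x\<close> by blast
  qed
  \<comment> \<open>A member of \<open>Z\<close> that sees \<open>w\<close> and differs from
    \<open>x\<close> also sees \<open>x\<close>, so it is a common neighbour, excluded by
    \<open>apexZ\<close>.\<close>
  have NZ: "N w \<inter> Z \<subseteq> {x}"
  proof
    fix v assume v: "v \<in> N w \<inter> Z"
    show "v \<in> {x}"
    proof (rule ccontr)
      assume "v \<notin> {x}"
      moreover have "v \<noteq> w" using v by auto
      moreover have "adj v w" using v adj_sym[of w v] by simp
      ultimately have "adj v x" using far(1)[OF x, of v] v by simp
      then show False using apexZ[of v] v adj_sym[of v x] by simp
    qed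
  qed
  show thesis
  proof (rule that[OF wx NZ])
    show "adj v z" if "v \<in> Z" "v \<noteq> w" "v \<noteq> x" "adj w z" "adj x z" for v z
    proof -
      have "\<not> adj w v" using NZ that by auto
      then have "\<not> adj v w" using adj_sym by blast
      moreover have "v \<noteq> z" using apexZ that by blast
      ultimately show ?thesis using far(2)[OF x that(1-3), of z] that by blast
    qed
    show "y = x" if "adj w z" "adj x z" "adj w y" "adj z y" for z y
      using apex[OF x that] .
  qed
qed

end

section \<open>All degrees at most k, and some degree equal to k\<close>

locale low_cover = critical_cover +
  assumes g_le_0: "v \<in> verts H \<Longrightarrow> g v \<le> 0"
    and plain_ex: "\<exists>v\<in>verts H. g v = 0"
begin

definition M :: "'a set" where "M = {v \<in> V. g v < 0}"
definition P :: "'a set" where "P = {v \<in> V. g v = 0}"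
text \<open>These are the vertices of degree k that miss a vertex of smaller degree. By
  \<open>P_missing\<close> they have no slack, so with k odd they qualify for
  \<open>odd_no_slack_vertices\<close>.\<close>

definition Z :: "'a set" where "Z = {p \<in> P. M - N p \<noteq> {}}"

lemma M_P: "V = M \<union> P" "M \<inter> P = {}" "finite M" "finite P" "V - M = P" "V - P = M"
proof -
  have "g v < 0 \<or> g v = 0" if "v \<in> V" for v using g_le_0[OF that] by linarith
  then show "V = M \<union> P" "M \<inter> P = {}" "V - M = P" "V - P = M" unfolding M_def P_def by auto
qed (auto simp: M_def P_def finite_verts)

lemma sub: "M \<subseteq> V" "P \<subseteq> V"
  by (auto simp: M_def P_def)

lemma card_M_P: "card M + card P = 2 * k - 1"
proof -
  have "card V = card M + card P"
    unfolding M_P(1) using M_P(2-4) by (intro card_Un_disjoint)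
  then show ?thesis using card_verts by simp
qed

lemma d_P: "p \<in> P \<Longrightarrow> card (N p) = k"
  by (simp add: P_def g_def d_def)

lemma card_N_split: "card (N v) = card (N v \<inter> M) + card (N v \<inter> P)"
  using card_N_inter_split[OF sub(1), of v] M_P(5) by simp

lemma slack_P:
  assumes "p \<in> P" shows "slack p = 1 + (\<Sum>x\<in>M - N p. g x)"
proof -
  have "(\<Sum>x\<in>V - N p. g x) = (\<Sum>x\<in>M - N p. g x)"
  proof (rule sum.mono_neutral_right)
    show "\<forall>x\<in>(V - N p) - (M - N p). g x = 0"
    proof
      fix x assume "x \<in> (V - N p) - (M - N p)"
      then have "x \<in> V" "\<not> g x < 0" by (auto simp: M_def)
      then show "g x = 0" using g_le_0[of x] by linarith
    qed
  qed (use finite_verts in \<open>auto simp: M_def\<close>)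
  then show ?thesis
    using slack_eq_nonneighbours[of p] assms by (simp add: P_def)
qed

text \<open>By \<open>slack_P\<close> the slack of \<open>p\<close> is 1 plus the values of
  \<open>g\<close> at the missed vertices of \<open>M\<close>, each at most -1. Nonnegativity leaves
  room for only one of them, with value exactly -1.\<close>

lemma P_missing:
  assumes p: "p \<in> P" and r: "r \<in> M" "\<not> adj p r"
  shows "M - N p = {r}" "slack p = 0" "g r = -1"
proof -
  have "(\<Sum>x\<in>M - N p. g x) \<le> (\<Sum>x\<in>M - N p. -1)"
    by (intro sum_mono) (auto simp: M_def)
  then have "card (M - N p) \<le> 1"
    using slack_P[OF p] slack_nonneg[of p] by simp
  moreover have "finite (M - N p)" and rM: "r \<in> M - N p" using r M_P(3) by auto
  ultimately have "\<forall>x\<in>M - N p. \<forall>y\<in>M - N p. x = y"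
    using card_le_Suc0_iff_eq[of "M - N p"] by simp
  with rM show *: "M - N p = {r}" by blast
  have "slack p = 1 + g r" using slack_P[OF p] unfolding * by simp
  moreover have "g r < 0" using r by (simp add: M_def)
  ultimately show "slack p = 0" "g r = -1" using slack_nonneg[of p] by linarith+
qed

lemma card_missing:
  assumes "p \<in> P" shows "card (M - N p) \<le> 1"
proof (cases "M - N p = {}")
  case False
  then obtain r where "r \<in> M" "\<not> adj p r" unfolding N_def by blast
  then show ?thesis using P_missing(1)[OF assms] by simp
next
  case True
  then show ?thesis by (simp only: card.empty)
qed

lemma card_N_M:
  assumes "p \<in> P" shows "card (N p \<inter> M) + card (M - N p) = card M"
proof -
  have "card (M - N p) = card M - card (N p \<inter> M)"
    using card_Diff_subset_Int[of M "N p"] M_P(3) by (simp add: Int_commute)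
  moreover have "card (N p \<inter> M) \<le> card M" using M_P(3) by (intro card_mono) auto
  ultimately show ?thesis by simp
qed

lemma card_M_le: "card M \<le> k + 1"
proof -
  obtain p where "p \<in> P" using plain_ex by (auto simp: P_def)
  then show ?thesis using d_P[of p] card_N_split[of p] card_N_M[of p] card_missing[of p] by simp
qed

text \<open>If \<open>g r\<close> were at most -2, no vertex of \<open>P\<close> could miss
  \<open>r\<close>. Counting then gives \<open>N r = P\<close> and \<open>card M = k + 1\<close>, so
  \<open>p\<close> has no neighbour in \<open>P\<close> and no slack. The edge \<open>p r\<close>
  would need a triangle whose third vertex lies in both \<open>N p\<close> and
  \<open>P\<close>.\<close>

lemma g_M:
  assumes r: "r \<in> M" shows "g r = -1"
proof (rule ccontr)
  assume "g r \<noteq> -1"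
  then have g2: "g r \<le> -2" using r by (auto simp: M_def)
  obtain p where p: "p \<in> P" using plain_ex by (auto simp: P_def)
  have adj: "adj q r" if "q \<in> P" for q
    using P_missing(3)[OF that r] \<open>g r \<noteq> -1\<close> by blast
  then have "P \<subseteq> N r" using adj_sym by auto
  moreover have "card (N r) \<le> k - 2" using g2 by (simp add: g_def d_def)
  moreover have "card P \<ge> k - 2" using card_M_P card_M_le by linarith
  ultimately have "N r = P" "card P = k - 2"
    using card_seteq[OF finite_N, of P r] card_mono[OF finite_N, of P r] by auto
  then have "card M = k + 1" using card_M_P k_ge by simp
  then have "card (N p \<inter> P) = 0" "card (M - N p) = 1"
    using d_P[OF p] card_N_split[of p] card_N_M[OF p] card_missing[OF p] by linarith+
  then have "N p \<inter> P = {}" "M - N p \<noteq> {}" using M_P(4) by (simp, metis card.empty zero_neq_one)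
  then obtain t where "t \<in> M" "\<not> adj p t" unfolding N_def by blast
  then have "slack p = 0" using P_missing(2)[OF p] by blast
  then obtain y where "adj p y" "adj r y"
    using slack_0_not_isolated adj[OF p] by blast
  then have "y \<in> N p \<inter> N r" by simp
  then show False unfolding \<open>N r = P\<close> \<open>N p \<inter> P = {}\<close> by blast
qed

text \<open>The degree sum is the order times k, which is odd, minus \<open>card M\<close>, and it
  must be even.\<close>

lemma odd_card_M: "odd (card M)"
proof -
  have "(\<Sum>v\<in>V. d v) = (\<Sum>v\<in>M. d v) + (\<Sum>v\<in>P. d v)"
    unfolding M_P(1) using M_P(2-4) by (intro sum.union_disjoint)
  also have "\<dots> = int (card M) * (int k - 1) + int (card P) * int k"
  proof -
    have "d v = int k - 1" if "v \<in> M" for v using g_M[OF that] by (simp add: g_def)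
    moreover have "d v = int k" if "v \<in> P" for v using d_P[OF that] by (simp add: d_def)
    ultimately show ?thesis by simp
  qed
  also have "\<dots> = int (card M + card P) * int k - int (card M)"
    by (simp add: algebra_simps)
  finally have "int (card M + card P) * int k - int (card M) = 2 * int (card (edges H))"
    using handshake by metis
  then have "even (int (card M + card P) * int k - int (card M))"
    by (metis dvd_triv_left)
  moreover have "odd (card M + card P)" using card_M_P k_ge by simp
  ultimately show ?thesis using odd_k by (auto simp: even_diff)
qed

lemma card_missing_M:
  assumes "r \<in> M" shows "card (P - N r) + card M = card (N r \<inter> M) + k"
proof -
  have "card (P - N r) = card P - card (N r \<inter> P)"
    using card_Diff_subset_Int[of P "N r"] M_P(4) by (simp add: Int_commute)
  moreover have "card (N r \<inter> P) \<le> card P" using M_P(4) by (intro card_mono) auto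
  moreover have "card (N r) + 1 = k" using g_M[OF assms] by (simp add: g_def d_def)
  ultimately show ?thesis using card_N_split[of r] card_M_P k_ge by simp
qed

lemma card_N_P:
  assumes "p \<in> P" shows "card (N p \<inter> P) + card M = k + card (M - N p)"
  using d_P[OF assms] card_N_split[of p] card_N_M[OF assms] by simp

lemma Z_D:
  assumes "w \<in> Z" shows "w \<in> P" "slack w = 0" "card (N w) = k" "card (M - N w) = 1"
proof -
  show "w \<in> P" using assms by (simp add: Z_def)
  then show "card (N w) = k" by (rule d_P)
  obtain r where "r \<in> M" "\<not> adj w r" using assms unfolding Z_def N_def by blast
  from P_missing[OF \<open>w \<in> P\<close> this] show "slack w = 0" "card (M - N w) = 1" by simp_all
qed

lemma finite_Z: "finite Z"
  using M_P(4) by (simp add: Z_def)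

lemma in_Z:
  assumes "r \<in> M" "p \<in> P - N r" shows "p \<in> Z" "M - N p = {r}"
proof -
  have "\<not> adj p r" using assms adj_sym by auto
  then show "M - N p = {r}" using P_missing(1)[of p r] assms by blast
  then have "M - N p \<noteq> {}" by (simp only: insert_not_empty not_False_eq_True)
  then show "p \<in> Z" using assms unfolding Z_def by blast
qed

text \<open>Each member of \<open>Z\<close> misses exactly one vertex of \<open>M\<close>, so the
  sets \<open>P - N r\<close> partition \<open>Z\<close>.\<close>

lemma card_Z: "card Z = (\<Sum>r\<in>M. card (P - N r))"
proof -
  have "Z = (\<Union>r\<in>M. P - N r)"
  proof (intro equalityI subsetI)
    fix p assume "p \<in> Z"
    then obtain r where "p \<in> P" "r \<in> M" "\<not> adj p r" unfolding Z_def N_def by blast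
    then show "p \<in> (\<Union>r\<in>M. P - N r)" using adj_sym by auto
  qed (use in_Z in blast)
  also have "card \<dots> = (\<Sum>r\<in>M. card (P - N r))"
  proof (rule card_UN_disjoint)
    show "\<forall>r\<in>M. \<forall>s\<in>M. r \<noteq> s \<longrightarrow> (P - N r) \<inter> (P - N s) = {}"
      using in_Z(2) by (metis IntD1 IntD2 ex_in_conv singleton_inject)
  qed (use M_P in auto)
  finally show ?thesis .
qed

lemma Z_neighbour:
  assumes "card Z \<ge> 4" "w \<in> Z"
  obtains x where "adj w x" "N w \<inter> Z \<subseteq> {x}"
    and "\<And>v z. v \<in> Z \<Longrightarrow> v \<noteq> w \<Longrightarrow> v \<noteq> x \<Longrightarrow> adj w z \<Longrightarrow> adj x z \<Longrightarrow> adj v z"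
    and "\<And>z y. adj w z \<Longrightarrow> adj x z \<Longrightarrow> adj w y \<Longrightarrow> adj z y \<Longrightarrow> y = x"
  by (rule odd_no_slack_vertices[OF _ assms]) (use Z_D odd_k in auto)

text \<open>Here \<open>Z\<close> and \<open>N r\<close> both have k - 1 elements and partition
  \<open>P\<close>. A vertex of \<open>Z\<close> has at most one neighbour in \<open>Z\<close>, so
  its degree k forces it to see all of \<open>N r\<close> and exactly one vertex of
  \<open>Z\<close>. This is K^+ with first part \<open>insert r Z\<close>, where \<open>r\<close> is
  the unmatched vertex.\<close>

lemma card_M_1:
  assumes "card M = 1"
  shows "exceptional_or_Kplus H"
proof -
  obtain r where M: "M = {r}" using assms card_1_singletonE by blast
  have r: "r \<in> M" by (simp add: M)
  have "N r \<inter> M = {}" by (simp add: M)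
  then have cZ: "card (P - N r) = k - 1" using card_missing_M[OF r] assms k_ge by simp
  have Z: "Z = P - N r"
    using in_Z[OF r] adj_sym[of r] by (auto simp: Z_def M)
  have NrP: "N r \<subseteq> P" using N_subset[of r] \<open>N r \<inter> M = {}\<close> M_P(1) by blast
  have cN: "card (N r) = k - 1" using g_M[OF r] by (simp add: g_def d_def)
  have rP: "r \<notin> P" using r M_P(2) by blast
  have part: "P = Z \<union> N r" "Z \<inter> N r = {}" using NrP Z by blast+
  \<comment> \<open>For k at least 5 the set \<open>Z\<close> is large enough for
    \<open>Z_neighbour\<close>. For k = 3 it has only two elements.\<close>
  have few: "card (N w \<inter> Z) \<le> 1" if w: "w \<in> Z" for w
  proof (cases "k \<ge> 5")
    case True
    then have "card Z \<ge> 4" using cZ Z by simp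
    then obtain x where "N w \<inter> Z \<subseteq> {x}" using Z_neighbour[OF _ w] by metis
    then show ?thesis using card_mono[of "{x}" "N w \<inter> Z"] by simp
  next
    case False
    then have "k = 3" using k_ge odd_k by (cases "k = 4") auto
    then have "card (Z - {w}) = 1" using cZ Z w by simp
    moreover have "N w \<inter> Z \<subseteq> Z - {w}" by auto
    ultimately show ?thesis using card_mono[of "Z - {w}" "N w \<inter> Z"] finite_Z by simp
  qed
  have Zadj: "N r \<subseteq> N w" "card (N w \<inter> Z) = 1" if w: "w \<in> Z" for w
  proof -
    have "\<not> adj w r" using w Z adj_sym[of w r] by simp
    then have "N w \<subseteq> Z \<union> N r" using N_subset[of w] M_P(1) M part(1) by auto
    then have "N w = (N w \<inter> Z) \<union> (N w \<inter> N r)" by blast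
    moreover have "card ((N w \<inter> Z) \<union> (N w \<inter> N r)) = card (N w \<inter> Z) + card (N w \<inter> N r)"
      using part(2) finite_Z by (intro card_Un_disjoint) auto
    ultimately have sum: "card (N w \<inter> Z) + card (N w \<inter> N r) = k" using Z_D(3)[OF w] by simp
    moreover have le: "card (N w \<inter> N r) \<le> k - 1"
      using card_mono[of "N r" "N w \<inter> N r"] cN by simp
    ultimately have "card (N w \<inter> N r) = k - 1" using few[OF w] k_ge by linarith
    then have "N w \<inter> N r = N r" using cN by (intro card_subset_eq) auto
    then show "N r \<subseteq> N w" by blast
    show "card (N w \<inter> Z) = 1" using sum le few[OF w] k_ge by linarith
  qed
  have NQ: "N q = insert r Z" if q: "q \<in> N r" for q
  proof -
    have "adj q z" if "z \<in> Z" for z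
      using q Zadj(1)[OF that] adj_sym[of q z] by auto
    then have "insert r Z \<subseteq> N q"
      using q adj_sym[of q r] by auto
    moreover have "r \<notin> Z" using rP Z by blast
    then have "card (insert r Z) = k" using finite_Z cZ Z k_ge by simp
    moreover have "card (N q) = k" using d_P q NrP by blast
    ultimately show ?thesis using card_subset_eq[OF finite_N] by metis
  qed
  have iso: "isomorphic H (Kplus (card (insert r Z)) (card (N r)))"
  proof (rule isomorphic_Kplus)
    show "V = insert r Z \<union> N r" using M_P(1) M part(1) by simp
    show disj: "insert r Z \<inter> N r = {}" using part(2) by simp
    show "\<not> adj x y" if "x \<in> N r" "y \<in> N r" for x y
      using NQ[OF that(1)] that(2) disj by (metis IntI N_iff empty_iff)
    show "adj x y" if "x \<in> insert r Z" "y \<in> N r" for x y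
      using that(2) NQ[OF that(2)] that(1) adj_sym[of x y] by (metis N_iff)
    have rlone: "\<not> adj r y" if "y \<in> insert r Z" for y
      using that disj by auto
    show "y = z" if "x \<in> insert r Z" "y \<in> insert r Z" "z \<in> insert r Z" "adj x y" "adj x z" for x y z
    proof -
      have "x \<noteq> r" using rlone that by blast
      then have x: "x \<in> Z" using that by blast
      have "\<not> adj x r" using rlone[OF that(1)] adj_sym by blast
      then have "y \<in> N x \<inter> Z" "z \<in> N x \<inter> Z" using that by auto
      then show ?thesis using Zadj(2)[OF x] by (metis card_1_singletonE singletonD)
    qed
    show "x = y" if "x \<in> insert r Z" "y \<in> insert r Z"
      "\<forall>z\<in>insert r Z. \<not> adj x z" "\<forall>z\<in>insert r Z. \<not> adj y z" for x y
    proof -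
      have "v = r" if "v \<in> insert r Z" "\<forall>z\<in>insert r Z. \<not> adj v z" for v
      proof (rule ccontr)
        assume "v \<noteq> r"
        then have "card (N v \<inter> Z) = 1" using that Zadj(2) by blast
        then have "N v \<inter> Z \<noteq> {}" by auto
        then show False using that by auto
      qed
      then show ?thesis using that by blast
    qed
  qed
  have "card (insert r Z) = k" using finite_Z cZ Z k_ge rP by simp
  then show ?thesis
    using KplusI[OF iso] cN card_verts k_ge by simp
qed

text \<open>Each \<open>r\<close> in \<open>M\<close> is missed by at least k - |M| vertices of
  \<open>P\<close>, and these sets are disjoint, so |M| (k - |M|) is at most |P| = 2k - 1 - |M|.
  Only |M| = 3 and k = 5 survive. Then \<open>Z = P\<close>, where every vertex has three neighbours
  in \<open>P\<close> but at most one in \<open>Z\<close>.\<close>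

lemma card_M_between:
  assumes "card M \<ge> 3" "card M + 2 \<le> k"
  shows False
proof -
  have "int (card P) \<ge> int (card M) * (int k - int (card M))"
  proof -
    have "int (card M) * (int k - int (card M)) = (\<Sum>r\<in>M. int k - int (card M))" by simp
    also have "\<dots> \<le> (\<Sum>r\<in>M. int (card (P - N r)))"
    proof (rule sum_mono)
      fix r assume "r \<in> M"
      then show "int k - int (card M) \<le> int (card (P - N r))" using card_missing_M[of r] by linarith
    qed
    also have "\<dots> = int (card Z)" by (simp add: card_Z)
    also have "\<dots> \<le> int (card P)" using card_mono[OF M_P(4), of Z] by (simp add: Z_def)
    finally show ?thesis .
  qed
  then have prod: "(int (card M) - 2) * (int k - int (card M) - 1) \<le> 1"
    using card_M_P k_ge by (simp add: algebra_simps of_nat_diff)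
  have "int (card M) - 2 \<le> 1"
  proof (rule ccontr)
    assume "\<not> int (card M) - 2 \<le> 1"
    then have "2 * 1 \<le> (int (card M) - 2) * (int k - int (card M) - 1)"
      using assms by (intro mult_mono) auto
    then show False using prod by linarith
  qed
  then have M3: "card M = 3" using assms by linarith
  then have k5: "k = 5" using prod assms by simp
  have cP: "card P = 6" using card_M_P M3 k5 by simp
  have "card Z \<ge> 6"
  proof -
    have "(\<Sum>r\<in>M. card (P - N r)) \<ge> (\<Sum>r\<in>M. 2)"
    proof (rule sum_mono)
      fix r assume "r \<in> M"
      then show "2 \<le> card (P - N r)" using card_missing_M[of r] M3 k5 by linarith
    qed
    then show ?thesis using M3 by (simp add: card_Z)
  qed
  then have ZP: "Z = P" using cP M_P(4) by (intro card_seteq) (auto simp: Z_def)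
  have "P \<noteq> {}" using cP by auto
  then obtain w where w: "w \<in> Z" using ZP by blast
  have "card Z \<ge> 4" using \<open>card Z \<ge> 6\<close> by simp
  from Z_neighbour[OF this w] obtain x where "N w \<inter> Z \<subseteq> {x}" by metis
  then have "card (N w \<inter> P) \<le> 1" using card_mono[of "{x}" "N w \<inter> Z"] ZP by simp
  moreover have "card (N w \<inter> P) + 3 = 5 + 1"
    using card_N_P[of w] Z_D[OF w] M3 k5 by simp
  ultimately show False by simp
qed

lemma card_4_le: "distinct [a, b, c, e] \<Longrightarrow> {a, b, c, e} \<subseteq> Z \<Longrightarrow> card Z \<ge> 4"
  using card_mono[OF finite_Z, of "{a, b, c, e}"] by simp

text \<open>For \<open>card M = k\<close> the counts balance: a vertex of \<open>M\<close> is missed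
  by as many vertices of \<open>P\<close> as it has neighbours in \<open>M\<close>, and a vertex of
  \<open>P\<close> has as many neighbours in \<open>P\<close> as it misses vertices of
  \<open>M\<close>.\<close>

lemma card_M_k:
  assumes Mk: "card M = k"
  shows False
proof -
  have zb: "card (P - N r) = card (N r \<inter> M)" if "r \<in> M" for r
    using card_missing_M[OF that] Mk by simp
  have NP: "card (N p \<inter> P) = card (M - N p)" if "p \<in> P" for p
    using card_N_P[OF that] Mk by simp
  have nbr: "\<exists>a. a \<in> P - N s" if "s \<in> M" "t \<in> M" "adj s t" for s t
  proof -
    have "t \<in> N s \<inter> M" using that by simp
    then have "card (N s \<inter> M) > 0" using M_P(3) by (auto simp: card_gt_0_iff)
    then have "card (P - N s) > 0" using zb[OF that(1)] by simp
    then show ?thesis by (auto simp: card_gt_0_iff)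
  qed
  have two: "\<exists>a b. a \<in> B \<and> b \<in> B \<and> a \<noteq> b" if "card A = card B" "{x, y} \<subseteq> A" "x \<noteq> y" "finite A" "finite B"
    for A B :: "'a set" and x y
  proof -
    have "card {x, y} \<le> card A" using that(2,4) by (intro card_mono)
    then have "\<not> card B \<le> Suc 0" using that(1,3) by simp
    then show ?thesis using card_le_Suc0_iff_eq[OF that(5)] by blast
  qed
  show False
  \<comment> \<open>If \<open>Z\<close> is empty, \<open>M\<close> and \<open>P\<close> are both
    independent and completely joined. Then \<open>r\<close> has slack zero although the edge
    \<open>r p\<close> lies in no triangle. Otherwise \<open>w\<close> in \<open>Z\<close> has one
    neighbour \<open>x0\<close> in \<open>P\<close>, which again lies in \<open>Z\<close>; they miss
    \<open>r0\<close> and \<open>r1\<close> respectively.\<close>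
  proof (cases "Z = {}")
    case True
    have MP: "adj p r" if "p \<in> P" "r \<in> M" for p r
      using that True unfolding Z_def N_def by blast
    have "M \<noteq> {}" using Mk k_ge by auto
    then obtain r where r: "r \<in> M" by blast
    obtain p where p: "p \<in> P" using plain_ex by (auto simp: P_def)
    have PNr: "P \<subseteq> N r" using MP[OF _ r] adj_sym by auto
    then have "P - N r = {}" by blast
    then have "card (N r \<inter> M) = 0" using zb[OF r] by (metis card.empty)
    then have "N r \<inter> M = {}" using M_P(3) by simp
    then have "N r \<subseteq> P" using N_subset[of r] unfolding M_P(1) by blast
    then have Nr: "N r = P" using PNr by (rule equalityI)
    then have "V - N r = M" using M_P(6) by simp
    moreover have "(\<Sum>x\<in>M. g x) = - int k" using g_M Mk by simp
    moreover have "r \<in> V" using r sub(1) by blast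
    ultimately have "slack r = 0"
      using slack_eq_nonneighbours[of r] g_M[OF r] by simp
    moreover have "adj r p" using p PNr by auto
    ultimately obtain y where "adj r y" "adj p y" using slack_0_not_isolated[of r p] by blast
    then have "y \<in> N p \<inter> N r" by simp
    then have "y \<in> N p \<inter> P" unfolding Nr .
    moreover have "N p \<inter> P = {}"
    proof -
      have "M - N p = {}" using MP[OF p] by auto
      then have "card (N p \<inter> P) = 0" using NP[OF p] by (metis card.empty)
      then show ?thesis using M_P(4) by simp
    qed
    ultimately show False by blast
  next
    case False
    then obtain w where w: "w \<in> Z" by blast
    have wP: "w \<in> P" and sw: "slack w = 0" using Z_D[OF w] by blast+
    obtain r0 where r0: "M - N w = {r0}" using Z_D(4)[OF w] card_1_singletonE by blast
    have "card (N w \<inter> P) = 1" using NP[OF wP] Z_D(4)[OF w] by simp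
    then obtain x0 where x0: "N w \<inter> P = {x0}" using card_1_singletonE by blast
    have "x0 \<in> N w \<inter> P" unfolding x0 by simp
    then have wx: "adj w x0" "adj x0 w" "x0 \<in> P" using adj_sym[of w x0] by simp_all
    then have "w \<in> N x0 \<inter> P" using wP by simp
    then have "N x0 \<inter> P \<noteq> {}" by blast
    then have "M - N x0 \<noteq> {}" using NP[OF wx(3)] M_P(4) by (metis card_0_eq card.empty finite_Int)
    then have x0Z: "x0 \<in> Z" using wx(3) by (simp add: Z_def)
    have sx: "slack x0 = 0" using Z_D[OF x0Z] by blast
    obtain r1 where r1: "M - N x0 = {r1}" using Z_D(4)[OF x0Z] card_1_singletonE by blast
    have Nx0: "N x0 \<inter> P = {w}"
    proof -
      have "card (N x0 \<inter> P) = 1" using NP[OF wx(3)] r1 by simp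
      then show ?thesis using \<open>w \<in> N x0 \<inter> P\<close> by (metis card_1_singletonE singletonD)
    qed
    have "r0 \<in> M - N w" "r1 \<in> M - N x0" unfolding r0 r1 by simp_all
    then have rM: "r0 \<in> M" "r1 \<in> M" "\<not> adj w r0" "\<not> adj x0 r1" by simp_all
    have sole: "adj u s" if "M - N u = {r}" "s \<in> M" "s \<noteq> r" for u r s
    proof (rule ccontr)
      assume "\<not> adj u s"
      then have "s \<in> M - N u" using that(2) by simp
      then show False unfolding that(1) using that(3) by simp
    qed
    note wM = sole[OF r0] and xM = sole[OF r1]
    \<comment> \<open>The triangle on the edge \<open>w r1\<close> cannot use \<open>x0\<close>,
      which misses \<open>r1\<close>, and \<open>x0\<close> is the only neighbour of
      \<open>w\<close> in \<open>P\<close>. So its third vertex lies in \<open>M\<close>.\<close>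
    have other: "\<exists>s\<in>M. s \<noteq> r0 \<and> s \<noteq> r1 \<and> adj r1 s" if "r0 \<noteq> r1"
    proof -
      obtain s where s: "adj w s" "adj r1 s"
        using slack_0_not_isolated[OF sw wM[OF rM(2)]] \<open>r0 \<noteq> r1\<close> by blast
      have "s \<noteq> x0" using s(2) rM(4) adj_sym by blast
      moreover have "s \<in> N w \<inter> P" if "s \<in> P" using that s(1) by simp
      ultimately have "s \<notin> P" unfolding x0 by blast
      then have "s \<in> M" using s(1) adj_verts[OF s(1)] M_P(1) by simp
      moreover have "s \<noteq> r0" "s \<noteq> r1" using s rM by auto
      ultimately show ?thesis using s by blast
    qed
    have other': "\<exists>s\<in>M. s \<noteq> r0 \<and> s \<noteq> r1 \<and> adj r0 s" if "r0 \<noteq> r1"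
    proof -
      obtain s where s: "adj x0 s" "adj r0 s"
        using slack_0_not_isolated[OF sx xM[OF rM(1)]] \<open>r0 \<noteq> r1\<close> by blast
      have "s \<noteq> w" using s(2) rM(3) adj_sym by blast
      moreover have "s \<in> N x0 \<inter> P" if "s \<in> P" using that s(1) by simp
      ultimately have "s \<notin> P" unfolding Nx0 by blast
      then have "s \<in> M" using s(1) adj_verts[OF s(1)] M_P(1) by simp
      moreover have "s \<noteq> r0" "s \<noteq> r1" using s rM by auto
      ultimately show ?thesis using s by blast
    qed
    have missw: "a \<noteq> w" if "a \<in> P - N s" "s \<in> M" "s \<noteq> r0" for a s
      using in_Z(2)[OF that(2,1)] r0 that(3) by (metis singleton_inject)
    have missx: "a \<noteq> x0" if "a \<in> P - N s" "s \<in> M" "s \<noteq> r1" for a s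
      using in_Z(2)[OF that(2,1)] r1 that(3) by (metis singleton_inject)
    have "x0 \<noteq> w" using wx by auto
    \<comment> \<open>Besides \<open>w\<close> and \<open>x0\<close>, two further members of
      \<open>Z\<close> are found as vertices missing some \<open>s\<close> or \<open>t\<close> in
      \<open>M\<close> that is adjacent to \<open>r0\<close> or \<open>r1\<close>. Different
      vertices of \<open>M\<close> are missed by different members of \<open>Z\<close>.\<close>
    have card4: "card Z \<ge> 4"
    proof (cases "r0 = r1")
      case True
      have "{w, x0} \<subseteq> P - N r0"
        using wP wx(3) rM adj_sym[of r0] unfolding True by simp
      then obtain s t where st: "s \<in> N r0 \<inter> M" "t \<in> N r0 \<inter> M" "s \<noteq> t"
        using two[OF zb[OF rM(1)], of w x0] \<open>x0 \<noteq> w\<close> M_P(3,4) by blast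
      have ne: "s \<noteq> r0" "t \<noteq> r0" using st by auto
      have "adj s r0" "adj t r0" using st adj_sym[of r0] by auto
      then obtain a b where ab: "a \<in> P - N s" "b \<in> P - N t"
        using nbr[of s r0] nbr[of t r0] st rM by blast
      have "s \<in> M" "t \<in> M" using st by simp_all
      then have "a \<noteq> b" using in_Z(2)[OF _ ab(1)] in_Z(2)[OF _ ab(2)] st(3) by (metis singleton_inject)
      then have "distinct [w, x0, a, b]"
        using missw[OF ab(1)] missw[OF ab(2)] missx[OF ab(1)] missx[OF ab(2)] st ne True \<open>x0 \<noteq> w\<close> by auto
      moreover have "{w, x0, a, b} \<subseteq> Z" using w x0Z in_Z(1) ab st by blast
      ultimately show ?thesis by (rule card_4_le)
    next
      case False
      obtain s where s: "s \<in> M" "s \<noteq> r0" "s \<noteq> r1" "adj r1 s" using other[OF False] by blast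
      obtain t where t: "t \<in> M" "t \<noteq> r0" "t \<noteq> r1" "adj r0 t" using other'[OF False] by blast
      have rev: "adj s r1" "adj t r0" using s t adj_sym by blast+
      obtain a b where ab: "a \<in> P - N s" "b \<in> P - N t" "a \<noteq> b"
      proof (cases "s = t")
        case True
        then have "{r0, r1} \<subseteq> N s \<inter> M" using rev rM by auto
        then show thesis
          using two[OF zb[OF s(1), symmetric], of r0 r1] False M_P(3,4) that True by blast
      next
        case ne: False
        obtain a b where ab: "a \<in> P - N s" "b \<in> P - N t"
          using nbr[OF s(1) rM(2) rev(1)] nbr[OF t(1) rM(1) rev(2)] by blast
        moreover have "a \<noteq> b"
          using in_Z(2)[OF s(1) ab(1)] in_Z(2)[OF t(1) ab(2)] ne by (metis singleton_inject)
        ultimately show thesis using that by blast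
      qed
      then have "distinct [w, x0, a, b]"
        using missw[OF ab(1)] missw[OF ab(2)] missx[OF ab(1)] missx[OF ab(2)] s t \<open>x0 \<noteq> w\<close> by auto
      moreover have "{w, x0, a, b} \<subseteq> Z" using w x0Z in_Z(1) ab s t by blast
      ultimately show ?thesis by (rule card_4_le)
    qed
    obtain x where "adj w x" and x: "N w \<inter> Z \<subseteq> {x}"
      and common: "\<And>v z. v \<in> Z \<Longrightarrow> v \<noteq> w \<Longrightarrow> v \<noteq> x \<Longrightarrow> adj w z \<Longrightarrow> adj x z \<Longrightarrow> adj v z"
      and apex: "\<And>z y. adj w z \<Longrightarrow> adj x z \<Longrightarrow> adj w y \<Longrightarrow> adj z y \<Longrightarrow> y = x"
    proof (rule Z_neighbour[OF card4 w])
      fix x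
      assume "adj w x" "N w \<inter> Z \<subseteq> {x}"
        "\<And>v z. v \<in> Z \<Longrightarrow> v \<noteq> w \<Longrightarrow> v \<noteq> x \<Longrightarrow> adj w z \<Longrightarrow> adj x z \<Longrightarrow> adj v z"
        "\<And>z y. adj w z \<Longrightarrow> adj x z \<Longrightarrow> adj w y \<Longrightarrow> adj z y \<Longrightarrow> y = x"
      then show thesis by (rule that)
    qed
    have "x0 \<in> N w \<inter> Z" using wx x0Z by simp
    then have "x = x0" using x by blast
    \<comment> \<open>Otherwise \<open>s\<close> is a common neighbour of \<open>w\<close> and
      \<open>x0\<close>, while \<open>r1\<close> is a common neighbour of \<open>w\<close> and
      \<open>s\<close>. Then \<open>apex\<close> would identify \<open>r1\<close> in
      \<open>M\<close> with \<open>x0\<close> in \<open>P\<close>.\<close>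
    have r01: "r0 = r1"
    proof (rule ccontr)
      assume ne: "r0 \<noteq> r1"
      obtain s where s: "s \<in> M" "s \<noteq> r0" "s \<noteq> r1" "adj r1 s" using other[OF ne] by blast
      have "adj s r1" using s adj_sym by blast
      then have "r1 = x0"
        using apex[of s r1] wM[OF s(1,2)] xM[OF s(1,3)] wM[OF rM(2)] ne \<open>x = x0\<close> by blast
      then show False using rM wx(3) M_P(2) by blast
    qed
    have "w \<in> P - N r0" using wP rM adj_sym[of r0 w] by simp
    then have "card (N r0 \<inter> M) > 0" using zb[OF rM(1)] M_P(4) by (metis card_gt_0_iff empty_iff finite_Diff)
    then obtain s where s: "adj r0 s" "s \<in> M" by (auto simp: card_gt_0_iff)
    have sr: "s \<noteq> r0" "adj s r0" using s(1) adj_sym[of r0 s] by auto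
    obtain a where a: "a \<in> P - N s" using nbr[OF s(2) rM(1) sr(2)] by blast
    have "a \<noteq> w" "a \<noteq> x" using missw[OF a s(2) sr(1)] missx[OF a s(2)] sr r01 \<open>x = x0\<close> by auto
    \<comment> \<open>Both \<open>w\<close> and \<open>x0\<close> see \<open>s\<close>, so every
      further member of \<open>Z\<close> sees it too, including \<open>a\<close>, which was chosen
      to miss \<open>s\<close>.\<close>
    then have "adj a s"
      using common[OF in_Z(1)[OF s(2) a], of s] wM[OF s(2) sr(1)] xM[OF s(2)] sr r01 \<open>x = x0\<close> by blast
    then show False using a adj_sym[of a s] by simp
  qed
qed

text \<open>Since \<open>card M\<close> and \<open>k\<close> are odd and \<open>card M\<close> is at
  most k + 1, the three preceding ranges of \<open>card M\<close> are exhaustive.\<close>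

lemma result: "exceptional_or_Kplus H"
proof -
  obtain m where "card M = 2 * m + 1" using odd_card_M by (rule oddE)
  moreover obtain j where "k = 2 * j + 1" using odd_k by (rule oddE)
  moreover have "m = 0 \<or> 1 \<le> m \<and> m < j \<or> m = j"
    using card_M_le calculation by linarith
  ultimately consider "card M = 1" | "card M \<ge> 3" "card M + 2 \<le> k" | "card M = k"
    by force
  then show ?thesis
    using card_M_1 card_M_between card_M_k by cases auto
qed

end

section \<open>Assembling order 1 modulo 4\<close>

context critical_cover
begin

lemma order_1_mod_4: "exceptional_or_Kplus H"
proof (cases "\<exists>p\<in>V. g p \<ge> 1")
  case True
  then show ?thesis using high_degree by blast
next
  case False
  then have le0: "g v \<le> 0" if "v \<in> V" for v using that by force
  show ?thesis
  proof (cases "\<exists>v\<in>V. g v = 0")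
    case True
    then interpret low_cover H TT k using le0 by unfold_locales
    show ?thesis by (rule result)
  next
    case False
    \<comment> \<open>With all values of \<open>g\<close> negative, every square is at least 1 and
      their total is at most the order, so \<open>g\<close> is constantly -1.\<close>
    then have neg: "g v \<le> -1" if "v \<in> V" for v using le0[OF that] that by force
    have sq: "1 \<le> (g v)\<^sup>2" if "v \<in> V" for v
    proof -
      have "1 * 1 \<le> (- g v) * (- g v)" using neg[OF that] by (intro mult_mono) auto
      then show ?thesis by (simp add: power2_eq_square)
    qed
    have "(\<Sum>v\<in>V. (g v)\<^sup>2) \<le> (\<Sum>v\<in>V. (g v)\<^sup>2 + slack v)"
      using slack_nonneg by (intro sum_mono) auto
    then have "(\<Sum>v\<in>V. (g v)\<^sup>2) \<le> int (card V) * 1" using sum_g_sq card_V by simp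
    then have "(g v)\<^sup>2 = 1" if "v \<in> V" for v
      using sum_eq_lower_bound[OF finite_verts sq _ that] by simp
    then have "g v = -1" if "v \<in> V" for v
      using neg[OF that] that power2_eq_1_iff[of "g v"] by force
    then show ?thesis using regular[of "-1"] by simp
  qed
qed

end

section \<open>Dominating sets\<close>

lemma finite_ksubsets: "finite (ksubsets n j)"
  by (simp add: ksubsets_def)

lemma card_ksubsets: "card (ksubsets n j) = n choose j"
  using n_subsets[of "{1..n}" j] by (simp add: ksubsets_def)

lemma adjacent_H_of:
  "adjacent (H_of n D) x y \<longleftrightarrow> x \<in> {1..n} \<and> y \<in> {1..n} \<and> x \<noteq> y \<and> {x, y} \<notin> D \<and>
     (\<exists>z\<in>{1..n} - {x, y}. {x, y, z} \<in> D)"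
proof -
  have "{x, y} \<in> {{a, b} | a b. R a b} \<longleftrightarrow> R x y \<or> R y x" for R :: "nat \<Rightarrow> nat \<Rightarrow> bool"
    by (auto simp: doubleton_eq_iff)
  then show ?thesis
    unfolding adjacent_def H_of_def by (simp add: insert_commute) blast
qed

lemma adjacent_G32:
  "adjacent (G32 n) X Y \<longleftrightarrow>
     X \<in> ksubsets n 2 \<and> Y \<in> ksubsets n 3 \<and> X \<subseteq> Y \<or> Y \<in> ksubsets n 2 \<and> X \<in> ksubsets n 3 \<and> Y \<subseteq> X"
proof -
  have "{X, Y} \<in> {{A, B} | A B. R A B} \<longleftrightarrow> R X Y \<or> R Y X" for R :: "nat set \<Rightarrow> nat set \<Rightarrow> bool"
    by (auto simp: doubleton_eq_iff)
  then show ?thesis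
    unfolding adjacent_def G32_def by simp
qed

lemma ksubsets_disjoint: "ksubsets n 2 \<inter> ksubsets n 3 = {}"
  by (auto simp: ksubsets_def)

lemma dominating_pair:
  assumes "dominating (G32 n) D" "A \<in> ksubsets n 2" "A \<notin> D"
  shows "\<exists>X\<in>D \<inter> ksubsets n 3. A \<subseteq> X"
proof -
  have "A \<in> verts (G32 n) - D" using assms by (simp add: G32_def)
  then obtain X where "X \<in> D" "adjacent (G32 n) A X"
    using assms(1) unfolding dominating_def by blast
  then show ?thesis using assms(2) ksubsets_disjoint[of n] unfolding adjacent_G32 by blast
qed

lemma dominating_triple:
  assumes "dominating (G32 n) D" "X \<in> ksubsets n 3" "X \<notin> D"
  shows "\<exists>A\<in>D \<inter> ksubsets n 2. A \<subseteq> X"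
proof -
  have "X \<in> verts (G32 n) - D" using assms by (simp add: G32_def)
  then obtain A where "A \<in> D" "adjacent (G32 n) X A"
    using assms(1) unfolding dominating_def by blast
  then show ?thesis using assms(2) ksubsets_disjoint[of n] unfolding adjacent_G32 by blast
qed

text \<open>A pair outside \<open>D\<close> is dominated by a triple of \<open>D\<close>, so the
  shadow condition in the description of the edges holds for it automatically.\<close>

lemma edges_H_of_dominating:
  assumes "dominating (G32 n) D"
  shows "edges (H_of n D) = ksubsets n 2 - D"
proof -
  have "D \<subseteq> verts (G32 n)" using assms by (simp add: dominating_def)
  from edges_H_of[OF this] have E: "edges (H_of n D) =
    {A. card A = 2 \<and> (\<exists>X \<in> D \<inter> ksubsets n 3. A \<subseteq> X)} - D \<inter> ksubsets n 2" .
  show ?thesis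
  proof (intro equalityI subsetI)
    fix A assume "A \<in> edges (H_of n D)"
    then have A: "card A = 2" "\<exists>X \<in> D \<inter> ksubsets n 3. A \<subseteq> X" "A \<notin> D \<inter> ksubsets n 2"
      unfolding E by simp_all
    then have "A \<in> ksubsets n 2" by (auto simp: ksubsets_def)
    then show "A \<in> ksubsets n 2 - D" using A(3) by blast
  next
    fix A assume A: "A \<in> ksubsets n 2 - D"
    then have "\<exists>X\<in>D \<inter> ksubsets n 3. A \<subseteq> X" using dominating_pair[OF assms] by blast
    moreover have "card A = 2" using A by (simp add: ksubsets_def)
    ultimately show "A \<in> edges (H_of n D)" unfolding E using A by simp
  qed
qed

text \<open>The edges are the pairs outside \<open>D\<close>, so their number minus the number of
  triples in \<open>D\<close> is \<open>n choose 2\<close> minus \<open>card D\<close>. A triangle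
  of the graph contains no pair of \<open>D\<close>, hence domination puts the triple itself into
  \<open>D\<close>.\<close>

lemma extremal_cover_H_of:
  assumes dom: "dominating (G32 n) D"
    and card: "int (card D) = int (n choose 2) - int ((n + 1)\<^sup>2 div 8)"
  shows "extremal_cover (H_of n D) (D \<inter> ksubsets n 3)"
proof
  let ?H = "H_of n D"
  have verts: "verts ?H = {1..n}" by (simp add: H_of_def)
  show "simple_graph ?H" by (rule simple_graph_H_of)
  show "finite (verts ?H)" by (simp add: verts)
  show "T \<subseteq> verts ?H \<and> card T = 3" if "T \<in> D \<inter> ksubsets n 3" for T
    using that by (simp add: verts ksubsets_def)
  show "{x, y, z} \<in> D \<inter> ksubsets n 3"
    if xy: "adjacent ?H x y" and yz: "adjacent ?H y z" and xz: "adjacent ?H x z" for x y z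
  proof -
    have ne: "x \<noteq> y" "y \<noteq> z" "x \<noteq> z" and notin: "{x, y} \<notin> D" "{y, z} \<notin> D" "{x, z} \<notin> D"
      using xy yz xz by (simp_all add: adjacent_H_of)
    have k3: "{x, y, z} \<in> ksubsets n 3"
      using xy yz ne by (simp add: adjacent_H_of ksubsets_def)
    have "{x, y, z} \<in> D"
    proof (rule ccontr)
      assume "{x, y, z} \<notin> D"
      then obtain A where A: "A \<in> D" "A \<in> ksubsets n 2" "A \<subseteq> {x, y, z}"
        using dominating_triple[OF dom k3] by blast
      then have "card A = 2" by (simp add: ksubsets_def)
      then obtain a b where ab: "A = {a, b}" "a \<noteq> b" unfolding card_2_iff by blast
      then have "a \<in> {x, y, z}" "b \<in> {x, y, z}" using A(3) by simp_all
      then have "{a, b} = {x, y} \<or> {a, b} = {y, z} \<or> {a, b} = {x, z}"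
        using ab(2) by (auto simp: doubleton_eq_iff)
      then show False using A(1) notin unfolding ab(1) by auto
    qed
    then show ?thesis using k3 by blast
  qed
  show "\<exists>z. z \<noteq> x \<and> z \<noteq> y \<and> {x, y, z} \<in> D \<inter> ksubsets n 3" if "adjacent ?H x y" for x y
  proof -
    obtain z where "z \<in> {1..n} - {x, y}" "{x, y, z} \<in> D" "x \<noteq> y" "x \<in> {1..n}" "y \<in> {1..n}"
      using \<open>adjacent ?H x y\<close> unfolding adjacent_H_of by blast
    then show ?thesis by (intro exI[of _ z]) (simp add: ksubsets_def)
  qed
  show "int (card (edges ?H)) - int (card (D \<inter> ksubsets n 3)) = (int (card (verts ?H)) + 1)\<^sup>2 div 8"
  proof -
    have D: "D \<subseteq> ksubsets n 2 \<union> ksubsets n 3"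
      using dom by (simp add: dominating_def G32_def)
    then have "D = (D \<inter> ksubsets n 2) \<union> (D \<inter> ksubsets n 3)" by blast
    then have "card D = card (D \<inter> ksubsets n 2) + card (D \<inter> ksubsets n 3)"
      using finite_ksubsets ksubsets_disjoint[of n]
        card_Un_disjoint[of "D \<inter> ksubsets n 2" "D \<inter> ksubsets n 3"] by auto
    moreover have "card (edges ?H) = card (ksubsets n 2) - card (D \<inter> ksubsets n 2)"
      unfolding edges_H_of_dominating[OF dom]
      using card_Diff_subset_Int[of "ksubsets n 2" D] finite_ksubsets by (simp add: Int_commute)
    moreover have "card (D \<inter> ksubsets n 2) \<le> card (ksubsets n 2)"
      using finite_ksubsets by (intro card_mono) auto
    moreover have "int ((n + 1)\<^sup>2 div 8) = (int n + 1)\<^sup>2 div 8"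
      by (simp add: zdiv_int add.commute)
    ultimately show ?thesis
      using card by (simp add: verts card_ksubsets)
  qed
qed

theorem theorem2:
  fixes n :: nat and D :: "nat set set"
  assumes "n \<ge> 3"
    and "dominating (G32 n) D"
    and "int (card D) = int (n choose 2) - int ((n + 1)\<^sup>2 div 8)"
  shows "(n mod 4 = 0 \<longrightarrow> isomorphic (H_of n D) (Kplus (n div 2) (n div 2))) \<and>
         (n mod 4 = 1 \<longrightarrow>
            isomorphic (H_of n D) H5a \<or> isomorphic (H_of n D) H5b \<or> isomorphic (H_of n D) H9 \<or>
            (\<exists>s. 1 < s \<and> s < n \<and> 2 * s \<in> {n - 1, n + 1, n + 3} \<and>
                 isomorphic (H_of n D) (Kplus s (n - s)))) \<and>
         (n mod 4 = 2 \<longrightarrow> isomorphic (H_of n D) (Kplus ((n + 2) div 2) ((n - 2) div 2))) \<and>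
         (n mod 4 = 3 \<longrightarrow> isomorphic (H_of n D) (Kplus ((n + 1) div 2) ((n - 1) div 2)))"
proof -
  interpret extremal_cover "H_of n D" "D \<inter> ksubsets n 3"
    using assms(2,3) by (rule extremal_cover_H_of)
  have cardV: "card (verts (H_of n D)) = n" by (simp add: H_of_def)
  define q where "q = n div 4"
  have n_q: "n = 4 * q + n mod 4" unfolding q_def by simp
  show ?thesis
  proof (intro conjI impI)
    assume "n mod 4 = 0"
    then have n: "n = 4 * q" using n_q by simp
    then have "card (verts (H_of n D)) = 2 * (2 * q)" "2 * q \<ge> 2" using cardV assms(1) by simp_all
    from even_order[OF this] show "isomorphic (H_of n D) (Kplus (n div 2) (n div 2))"
      using n by simp
  next
    assume "n mod 4 = 1"
    then have n: "n = 4 * q + 1" using n_q by simp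
    \<comment> \<open>The value of k is (n + 1) / 2 = 2q + 1. The bound on n excludes q = 0, which
      gives k at least 3.\<close>
    interpret critical_cover "H_of n D" "D \<inter> ksubsets n 3" "2 * q + 1"
      by unfold_locales (use cardV n assms(1) in simp_all)
    show "isomorphic (H_of n D) H5a \<or> isomorphic (H_of n D) H5b \<or> isomorphic (H_of n D) H9 \<or>
        (\<exists>s. 1 < s \<and> s < n \<and> 2 * s \<in> {n - 1, n + 1, n + 3} \<and> isomorphic (H_of n D) (Kplus s (n - s)))"
      using order_1_mod_4 unfolding exceptional_or_Kplus_def cardV .
  next
    assume "n mod 4 = 2"
    then have n: "n = 4 * q + 2" using n_q by simp
    then have "card (verts (H_of n D)) = 2 * (2 * q + 1)" "2 * q + 1 \<ge> 2" using cardV assms(1) by simp_all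
    from even_order[OF this] show "isomorphic (H_of n D) (Kplus ((n + 2) div 2) ((n - 2) div 2))"
      using n by simp
  next
    assume "n mod 4 = 3"
    then have n: "n = 4 * q + 3" using n_q by simp
    then have "card (verts (H_of n D)) + 1 = 2 * (2 * q + 2)" "even (2 * q + 2)" "2 * q + 2 \<ge> 2"
      using cardV by simp_all
    from order_3_mod_4[OF this] show "isomorphic (H_of n D) (Kplus ((n + 1) div 2) ((n - 1) div 2))"
      using n by simp
  qed
qed

end
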